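(* Let $H$ be a Tonelli Hamiltonian on $\mathbb T^d$ with associated Lagrangian $L$ and critical value $\alpha(H)$. Let $(h_n)$ be mesh sizes and $(\tau_n)$ positive time steps with $$\tau_n\to0,\qquad h_n\to0,\qquad h_n/\tau_n\to0.$$ For each $n$ let $u_{h_n,\tau_n}:\mathcal G_{h_n}\to\mathbb R$ be a solution of $T_{h_n,\tau_n}u_{h_n,\tau_n}=u_{h_n,\tau_n}+\tau_n\bar L(h_n,\tau_n)$, normalized to vanish at a chosen grid point of $\mathcal G_{h_n}$, and let $\widetilde u_{h_n,\tau_n}$ denote its piecewise affine periodic interpolation on $\mathbb T^d$. Then there exist a subsequence (not relabeled) and a Lipschitz continuous function $u:\mathbb T^d\to\mathbb R$ such that $$\widetilde u_{h_n,\tau_n}\longrightarrow u\qquad\text{uniformly on }\mathbb T^d.$$ Moreover, $u$ is a viscosity solution of the critical Hamilton–Jacobi equation $H(x,Du)=\alpha(H)$ in $\mathbb T^d$.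
   Context: $\mathbb T^d=\mathbb R^d/\mathbb Z^d$. $H\in C^2(\mathbb T^d\times\mathbb R^d)$ is a Tonelli Hamiltonian: $D^2_{pp}H(x,p)>0$ everywhere and $H$ is superlinear in $p$. The Tonelli Lagrangian is $L(x,v)=\sup_{p\in\mathbb R^d}\{p\cdot v-H(x,p)\}$; it is of class $C^2$, strictly convex in $v$, and superlinear: for every $K>0$ there is $C(K)\in\mathbb R$ with $L(x,v)\ge K|v|-C(K)$ for all $(x,v)$. The critical value $\alpha(H)$ is the unique constant for which $H(x,Du(x))=\alpha(H)$, $x\in\mathbb T^d$, admits a viscosity solution. Mesh sizes are always of the form $h=1/N$ with $N\ge1$ an integer. The grid is $\mathcal G_h=\{x_i=ih \bmod \mathbb Z^d: i\in\{0,\dots,N-1\}^d\}$, and each grid point is identified with its representative in $[0,1)^d$. The fully-discrete Lax–Oleinik operator acts on $u_h:\mathcal G_h\to\mathbb R$ by $$(T_{h,\tau}u_h)(x_j)=\min_{x_i\in\mathcal G_h,\ \ell\in\mathbb Z^d}\Big\{u_h(x_i)+\tau L\Big(x_i,\frac{x_j+\ell-x_i}{\tau}\Big)\Big\},\qquad x_j\in\mathcal G_h.$$ $\bar L(h,\tau)\in\mathbb R$ is the unique constant for which $T_{h,\tau}u=u+\tau\bar L(h,\tau)$ has a solution $u:\mathcal G_h\to\mathbb R$. Piecewise affine periodic interpolation: the continuous function on $\mathbb T^d$ agreeing with the given grid function at the nodes and affine on each simplex of a standard periodic triangulation obtained by subdividing the grid cubes of side $h$ (e.g. the Kuhn triangulation).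 *)

theory Defs
  imports "HOL-Analysis.Analysis"
begin

text \<open>Functions on the torus $T^d = R^d / Z^d$ are represented by their $Z^d$-periodic lifts to
  \<open>real ^ 'n\<close>, with \<open>d = CARD('n)\<close>. A periodic function on \<open>real ^ 'n\<close> is continuous (Lipschitz)
  iff the function it induces on the torus is, and uniform convergence is the same on both.\<close>

text \<open>\<open>lattice h\<close> is $h Z^d$; in particular \<open>lattice 1\<close> is $Z^d$.\<close>

definition lattice :: "real \<Rightarrow> (real ^ 'n) set" where
  "lattice h = {x. \<forall>k. \<exists>m::int. x $ k = of_int m * h}"

definition periodic :: "(real ^ 'n \<Rightarrow> 'b) \<Rightarrow> bool" where
  "periodic f \<longleftrightarrow> (\<forall>x. \<forall>l \<in> lattice 1. f (x + l) = f x)"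

section \<open>Tonelli Hamiltonians\<close>

definition C2 :: "('a::real_normed_vector \<Rightarrow> real) \<Rightarrow> bool" where
  "C2 f \<longleftrightarrow> (\<exists>(f' :: 'a \<Rightarrow> 'a \<Rightarrow>\<^sub>L real) (f'' :: 'a \<Rightarrow> 'a \<Rightarrow>\<^sub>L ('a \<Rightarrow>\<^sub>L real)).
      (\<forall>x. (f has_derivative blinfun_apply (f' x)) (at x)) \<and>
      (\<forall>x. (f' has_derivative blinfun_apply (f'' x)) (at x)) \<and>
      continuous_on UNIV f'')"

definition partial :: "'n \<Rightarrow> (real ^ 'n \<Rightarrow> real) \<Rightarrow> real ^ 'n \<Rightarrow> real" where
  "partial i f p = frechet_derivative f (at p) (axis i 1)"

definition hessian :: "(real ^ 'n \<Rightarrow> real) \<Rightarrow> real ^ 'n \<Rightarrow> real ^ 'n ^ 'n" where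
  "hessian f p = (\<chi> i j. partial i (partial j f) p)"

definition positive_definite :: "real ^ 'n ^ 'n \<Rightarrow> bool" where
  "positive_definite A \<longleftrightarrow> (\<forall>v. v \<noteq> 0 \<longrightarrow> v \<bullet> (A *v v) > 0)"

text \<open>Superlinearity is uniform in the base point, as usual on a compact configuration space.\<close>

definition superlinear :: "(real ^ 'n \<Rightarrow> real ^ 'n \<Rightarrow> real) \<Rightarrow> bool" where
  "superlinear F \<longleftrightarrow> (\<forall>K>0. \<exists>C. \<forall>x p. F x p \<ge> K * norm p - C)"

definition tonelli_hamiltonian :: "(real ^ 'n \<Rightarrow> real ^ 'n \<Rightarrow> real) \<Rightarrow> bool" where
  "tonelli_hamiltonian H \<longleftrightarrow>
     periodic H \<and>
     C2 (\<lambda>(x, p). H x p) \<and>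
     (\<forall>x p. positive_definite (hessian (H x) p)) \<and>
     superlinear H"

definition lagrangian ::
  "(real ^ 'n \<Rightarrow> real ^ 'n \<Rightarrow> real) \<Rightarrow> real ^ 'n \<Rightarrow> real ^ 'n \<Rightarrow> real" where
  "lagrangian H x v = (SUP p. p \<bullet> v - H x p)"

section \<open>Viscosity solutions and the critical value\<close>

definition C1_gradient :: "(real ^ 'n \<Rightarrow> real) \<Rightarrow> (real ^ 'n \<Rightarrow> real ^ 'n) \<Rightarrow> bool" where
  "C1_gradient \<phi> D\<phi> \<longleftrightarrow> (\<forall>x. GDERIV \<phi> x :> D\<phi> x) \<and> continuous_on UNIV D\<phi>"

definition viscosity_subsolution ::
  "(real ^ 'n \<Rightarrow> real ^ 'n \<Rightarrow> real) \<Rightarrow> real \<Rightarrow> (real ^ 'n \<Rightarrow> real) \<Rightarrow> bool" where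
  "viscosity_subsolution H c u \<longleftrightarrow>
     (\<forall>\<phi> D\<phi> x. C1_gradient \<phi> D\<phi> \<longrightarrow>
        (\<forall>\<^sub>F y in nhds x. u y - \<phi> y \<le> u x - \<phi> x) \<longrightarrow> H x (D\<phi> x) \<le> c)"

definition viscosity_supersolution ::
  "(real ^ 'n \<Rightarrow> real ^ 'n \<Rightarrow> real) \<Rightarrow> real \<Rightarrow> (real ^ 'n \<Rightarrow> real) \<Rightarrow> bool" where
  "viscosity_supersolution H c u \<longleftrightarrow>
     (\<forall>\<phi> D\<phi> x. C1_gradient \<phi> D\<phi> \<longrightarrow>
        (\<forall>\<^sub>F y in nhds x. u y - \<phi> y \<ge> u x - \<phi> x) \<longrightarrow> H x (D\<phi> x) \<ge> c)"

text \<open>Solutions of $H(x, Du(x)) = c$ on the torus. As local extrema are a local notion, test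
  functions need not be periodic.\<close>

definition viscosity_solution ::
  "(real ^ 'n \<Rightarrow> real ^ 'n \<Rightarrow> real) \<Rightarrow> real \<Rightarrow> (real ^ 'n \<Rightarrow> real) \<Rightarrow> bool" where
  "viscosity_solution H c u \<longleftrightarrow>
     periodic u \<and> continuous_on UNIV u \<and>
     viscosity_subsolution H c u \<and> viscosity_supersolution H c u"

definition critical_value :: "(real ^ 'n \<Rightarrow> real ^ 'n \<Rightarrow> real) \<Rightarrow> real" where
  "critical_value H = (THE c. \<exists>u. viscosity_solution H c u)"

section \<open>The fully discrete Lax--Oleinik operator\<close>

definition mesh_size :: "real \<Rightarrow> bool" where
  "mesh_size h \<longleftrightarrow> (\<exists>N::nat. N \<ge> 1 \<and> h = 1 / real N)"

text \<open>Grid points are identified with their representatives in $[0,1)^d$. A grid function is a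
  function on \<open>real ^ 'n\<close> of which only the values on \<open>grid h\<close> are used.\<close>

definition grid :: "real \<Rightarrow> (real ^ 'n) set" where
  "grid h = {x \<in> lattice h. \<forall>k. 0 \<le> x $ k \<and> x $ k < 1}"

text \<open>For a superlinear continuous \<open>L\<close> the infimum below is attained, i.e. it is a minimum.\<close>

definition lax_oleinik ::
  "(real ^ 'n \<Rightarrow> real ^ 'n \<Rightarrow> real) \<Rightarrow> real \<Rightarrow> real \<Rightarrow> (real ^ 'n \<Rightarrow> real) \<Rightarrow> real ^ 'n \<Rightarrow> real" where
  "lax_oleinik L h \<tau> u y =
     (INF (x, l) \<in> grid h \<times> lattice 1. u x + \<tau> * L x ((y + l - x) /\<^sub>R \<tau>))"

definition discrete_solution ::
  "(real ^ 'n \<Rightarrow> real ^ 'n \<Rightarrow> real) \<Rightarrow> real \<Rightarrow> real \<Rightarrow> real \<Rightarrow> (real ^ 'n \<Rightarrow> real) \<Rightarrow> bool" where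
  "discrete_solution L h \<tau> c u \<longleftrightarrow> (\<forall>y \<in> grid h. lax_oleinik L h \<tau> u y = u y + \<tau> * c)"

definition effective_lagrangian ::
  "(real ^ 'n \<Rightarrow> real ^ 'n \<Rightarrow> real) \<Rightarrow> real \<Rightarrow> real \<Rightarrow> real" where
  "effective_lagrangian L h \<tau> = (THE c. \<exists>u. discrete_solution L h \<tau> c u)"

section \<open>Piecewise affine periodic interpolation\<close>

text \<open>A periodic triangulation of $R^d$ subdividing the grid cubes of side \<open>h\<close>, with vertices at
  the grid points only. The Kuhn triangulation is an example. The library predicate
  \<open>triangulation\<close> only covers finite families, so its face-to-face condition is restated here.\<close>

definition grid_triangulation :: "real \<Rightarrow> (real ^ 'n) set set \<Rightarrow> bool" where
  "grid_triangulation h \<T> \<longleftrightarrow>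
     (\<forall>T \<in> \<T>. int CARD('n) simplex T \<and>
              {x. x extreme_point_of T} \<subseteq> lattice h \<and>
              (\<exists>z \<in> lattice h. T \<subseteq> cbox z (z + (\<chi> k. h)))) \<and>
     \<Union>\<T> = UNIV \<and>
     (\<forall>T \<in> \<T>. \<forall>T' \<in> \<T>. (T \<inter> T') face_of T \<and> (T \<inter> T') face_of T') \<and>
     (\<forall>T \<in> \<T>. \<forall>l \<in> lattice 1. (+) l ` T \<in> \<T>)"

definition pw_affine_interpolation ::
  "real \<Rightarrow> (real ^ 'n) set set \<Rightarrow> (real ^ 'n \<Rightarrow> real) \<Rightarrow> (real ^ 'n \<Rightarrow> real) \<Rightarrow> bool" where
  "pw_affine_interpolation h \<T> u w \<longleftrightarrow>
     periodic w \<and> continuous_on UNIV w \<and>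
     (\<forall>x \<in> grid h. w x = u x) \<and>
     (\<forall>T \<in> \<T>. \<exists>a b. \<forall>x \<in> T. w x = a \<bullet> x + b)"

end

theory Submission
  imports Defs "HOL-Complex_Analysis.Great_Picard"
begin

text \<open>The discrete equation says that the interpolations satisfy the dynamic programming inequality
  along every pair of grid points and almost attain it at every grid point. Joining two grid points
  by grid paths with steps of length about \<open>\<tau>\<close> gives oscillation at most
  \<open>A * (distance + \<tau>)\<close>, because \<open>h / \<tau>\<close> is bounded; so a subsequence converges to a Lipschitz
  limit, along which the (bounded) constants converge to some \<open>\<gamma>\<close>. At grid extrema of
  \<open>w - \<psi>\<close> for a test function \<open>\<psi>\<close>, the inequality with a fixed velocity (rounded to the grid, with
  relative error \<open>h / \<tau>\<close>) gives the subsolution property, and an almost optimal velocity, bounded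
  by superlinearity, gives the supersolution property, both at level \<open>- \<gamma>\<close>. Doubling of variables shows
  that only one level admits a viscosity solution, hence it is the critical value.\<close>

section \<open>Convexity of the Hamiltonian and periodicity\<close>

lemma tonelli_continuous:
  assumes "tonelli_hamiltonian H"
  shows "continuous_on UNIV (\<lambda>(x, p). H x p)"
  using assms unfolding tonelli_hamiltonian_def C2_def
  by (meson has_derivative_continuous_on has_derivative_at_withinI)

text \<open>A positive Hessian makes \<open>H x\<close> convex: along each line through
  \<open>p\<close> the derivative is nondecreasing, so the mean value theorem keeps the graph above
  the tangent at \<open>p\<close>. The subgradient serves later as the velocity dual to a
  momentum.\<close>

lemma tonelli_subgradient:
  fixes H :: "real ^ 'n \<Rightarrow> real ^ 'n \<Rightarrow> real"
  assumes "tonelli_hamiltonian H"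
  obtains v where "\<And>q. H x p + v \<bullet> (q - p) \<le> H x q"
proof -
  obtain f' :: "(real ^ 'n) \<times> (real ^ 'n) \<Rightarrow> ((real ^ 'n) \<times> (real ^ 'n)) \<Rightarrow>\<^sub>L real" and f'' where
    f': "\<And>z. ((\<lambda>(x, p). H x p) has_derivative blinfun_apply (f' z)) (at z)"
    and f'': "\<And>z. (f' has_derivative blinfun_apply (f'' z)) (at z)"
    using assms unfolding tonelli_hamiltonian_def C2_def by blast
  have pd: "positive_definite (hessian (H x) q)" for q
    using assms unfolding tonelli_hamiltonian_def by blast
  \<comment> \<open>Derivatives of \<open>H\<close> on pairs are pulled back to the fibre over
    \<open>x\<close>, where the partial derivatives in \<open>hessian\<close> live.\<close>
  have slice: "((\<lambda>q. (x, q)) has_derivative (\<lambda>w. (0, w))) (at q)" for q :: "real ^ 'n"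
    by (auto intro!: derivative_eq_intros)
  have D1: "(H x has_derivative (\<lambda>w. f' (x, q) (0, w))) (at q)" for q
    using diff_chain_at[OF slice f'] by (simp add: o_def)
  have D2: "((\<lambda>q. f' (x, q) w) has_derivative (\<lambda>d. f'' (x, q) (0, d) w)) (at q)" for q w
    using bounded_linear.has_derivative[OF blinfun.bounded_linear_left diff_chain_at[OF slice f'']]
    by (simp add: o_def)
  have partial1: "partial j (H x) = (\<lambda>q. f' (x, q) (0, axis j 1))" for j
    by (rule ext) (simp add: partial_def frechet_derivative_at[OF D1, symmetric])
  have partial2: "partial i (partial j (H x)) q = f'' (x, q) (0, axis i 1) (0, axis j 1)" for i j q
    unfolding partial1 using frechet_derivative_at[OF D2, symmetric] by (simp add: partial_def)
  have expand: "(0, w) = (\<Sum>i\<in>UNIV. w $ i *\<^sub>R (0 :: real ^ 'n, axis i 1 :: real ^ 'n))" for w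
  proof -
    have "w = (\<Sum>i\<in>UNIV. w $ i *\<^sub>R axis i 1)"
      using basis_expansion[of w] by (simp add: scalar_mult_eq_scaleR)
    then show ?thesis
      by (simp add: prod_eq_iff fst_sum snd_sum)
  qed
  have lin: "bounded_linear (\<lambda>a. blinfun_apply (f'' z a) b)" for z b
    by (rule bounded_linear_compose[OF blinfun.bounded_linear_left blinfun.bounded_linear_right])
  have scale: "f'' z (0, s *\<^sub>R w) b = s * f'' z (0, w) b" for z s w b
    using linear_scale[OF bounded_linear.linear[OF lin[of z b]], of s "(0, w)"] by simp
  \<comment> \<open>Expanding both arguments in the standard basis identifies the second derivative
    along the fibre with the Hessian quadratic form.\<close>
  have second: "f'' (x, q) (0, w) (0, w) = w \<bullet> (hessian (H x) q *v w)" for q w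
  proof -
    have "f'' (x, q) (0, w) (0, w)
        = (\<Sum>i\<in>UNIV. w $ i * (\<Sum>j\<in>UNIV. w $ j * f'' (x, q) (0, axis i 1) (0, axis j 1)))"
      by (subst expand, subst bounded_linear.linear[OF lin, THEN linear_sum],
          subst (2) expand)
        (simp add: bounded_linear.linear[OF lin, THEN linear_scale] blinfun.sum_right blinfun.scaleR_right
          blinfun.scaleR_left sum_distrib_left mult_ac del: scaleR_Pair)
    then show ?thesis
      by (simp add: inner_vec_def matrix_vector_mult_def hessian_def partial2 mult.commute)
  qed
  have nonneg: "0 \<le> f'' (x, q) (0, w) (0, w)" for q w
    using pd[of q] unfolding second positive_definite_def
    by (cases "w = 0") (auto intro: less_imp_le)
  \<comment> \<open>The gradient of \<open>H x\<close> at \<open>p\<close>.\<close>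
  define v where "v = (\<chi> j. f' (x, p) (0, axis j 1))"
  have v: "v \<bullet> w = f' (x, p) (0, w)" for w
    by (subst expand) (simp add: v_def inner_vec_def blinfun.sum_right blinfun.scaleR_right mult.commute
        del: scaleR_Pair)
  have "H x p + v \<bullet> (q - p) \<le> H x q" for q
  proof -
    define w where "w = q - p"
    have line: "((\<lambda>t. p + t *\<^sub>R w) has_derivative (\<lambda>s. s *\<^sub>R w)) (at t)" for t
      by (auto intro!: derivative_eq_intros)
    have g1: "((\<lambda>t. H x (p + t *\<^sub>R w)) has_real_derivative f' (x, p + t *\<^sub>R w) (0, w)) (at t)" for t
      using diff_chain_at[OF line D1]
      unfolding has_field_derivative_def o_def
      by (rule has_derivative_eq_rhs) (auto simp: blinfun.scaleR_right[of _ _ "(0,w)", simplified])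
    have g2: "((\<lambda>t. f' (x, p + t *\<^sub>R w) (0, w)) has_real_derivative
        f'' (x, p + t *\<^sub>R w) (0, w) (0, w)) (at t)" for t
      using diff_chain_at[OF line D2]
      unfolding has_field_derivative_def o_def
      by (rule has_derivative_eq_rhs)
        (auto simp: scale)
    obtain t where t: "0 < t" "t < 1"
      "H x (p + 1 *\<^sub>R w) - H x (p + 0 *\<^sub>R w) = (1 - 0) * f' (x, p + t *\<^sub>R w) (0, w)"
      using MVT2[of 0 1 "\<lambda>t. H x (p + t *\<^sub>R w)", OF _ g1] by auto
    have "f' (x, p + 0 *\<^sub>R w) (0, w) \<le> f' (x, p + t *\<^sub>R w) (0, w)"
      by (rule DERIV_nonneg_imp_nondecreasing[OF less_imp_le[OF t(1)]]) (use g2 nonneg in blast)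
    then show ?thesis using t by (simp add: v w_def)
  qed
  then show thesis by (rule that)
qed

section \<open>Lattices and reduction modulo $Z^d$\<close>

lemma lattice_uminus: "l \<in> lattice h \<Longrightarrow> - l \<in> lattice h"
  unfolding lattice_def
  by (smt (verit) mem_Collect_eq mult_minus_left of_int_minus uminus_vec_def vec_lambda_beta
      vector_uminus_component)

lemma lattice_add: "\<lbrakk>l \<in> lattice h; m \<in> lattice h\<rbrakk> \<Longrightarrow> l + m \<in> lattice h"
  unfolding lattice_def by (simp, metis distrib_right of_int_add)

lemma lattice_diff: "\<lbrakk>l \<in> lattice h; m \<in> lattice h\<rbrakk> \<Longrightarrow> l - m \<in> lattice h"
  using lattice_add[OF _ lattice_uminus] by fastforce

text \<open>The mesh size is the inverse of an integer, so integers are multiples of it and integral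
  translations preserve the lattice.\<close>

lemma lattice_1_subset:
  assumes "mesh_size h" shows "lattice 1 \<subseteq> (lattice h :: (real ^ 'n) set)"
proof
  fix l :: "real ^ 'n" assume l: "l \<in> lattice 1"
  obtain N :: nat where N: "N \<ge> 1" "h = 1 / real N"
    using assms by (auto simp: mesh_size_def)
  show "l \<in> lattice h"
    unfolding lattice_def
  proof (intro CollectI allI)
    fix k
    obtain m where "l $ k = of_int m * 1" using l by (auto simp: lattice_def)
    then have "l $ k = of_int (m * int N) * h" using N by simp
    then show "\<exists>m. l $ k = of_int m * h" ..
  qed
qed

text \<open>The representative in $[0,1)^d$ of a point of the torus. Compactness of the torus is
  used through compactness of the closed cube that contains it.\<close>

definition fractional_part :: "real ^ 'n \<Rightarrow> real ^ 'n" where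
  "fractional_part x = (\<chi> k. frac (x $ k))"

lemma fractional_part_bounds: "0 \<le> fractional_part x $ k" "fractional_part x $ k < 1"
  by (auto simp: fractional_part_def frac_lt_1)

lemma fractional_part_diff: "fractional_part x - x \<in> lattice 1"
  unfolding lattice_def
proof (intro CollectI allI)
  fix k
  have "(fractional_part x - x) $ k = of_int (- \<lfloor>x $ k\<rfloor>) * 1"
    by (simp add: fractional_part_def frac_def)
  then show "\<exists>m. (fractional_part x - x) $ k = of_int m * 1" ..
qed

lemma fractional_part_cbox: "fractional_part x \<in> cbox 0 1"
  by (auto simp: mem_box_cart fractional_part_def less_imp_le[OF frac_lt_1])

lemma fractional_part_add:
  assumes "l \<in> lattice 1" shows "fractional_part (x + l) = fractional_part x"
proof -
  have "frac (x $ k + l $ k) = frac (x $ k)" for k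
    using assms by (auto simp: lattice_def) (metis frac_add_of_int_right)
  then show ?thesis by (simp add: fractional_part_def)
qed

lemma periodicD: "periodic f \<Longrightarrow> l \<in> lattice 1 \<Longrightarrow> f (x + l) = f x"
  by (auto simp: periodic_def)

lemma periodic_cong_lattice: "periodic f \<Longrightarrow> x - y \<in> lattice 1 \<Longrightarrow> f x = f y"
  using periodicD[of f "x - y" y] by simp

lemma periodic_fractional_part: "periodic f \<Longrightarrow> f (fractional_part x) = f x"
  using fractional_part_diff periodic_cong_lattice by blast

section \<open>Uniform control of the Hamiltonian over the torus\<close>

lemma tonelli_bounded:
  fixes H :: "real ^ 'n \<Rightarrow> real ^ 'n \<Rightarrow> real"
  assumes "tonelli_hamiltonian H"
  obtains M where "\<And>x p. norm p \<le> K \<Longrightarrow> \<bar>H x p\<bar> \<le> M"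
proof -
  have per: "periodic H" using assms by (simp add: tonelli_hamiltonian_def)
  have "compact ((\<lambda>(x, p). H x p) ` (cbox 0 1 \<times> cball 0 K))"
    by (intro compact_continuous_image continuous_on_subset[OF tonelli_continuous[OF assms]]
        compact_Times compact_cbox compact_cball) auto
  then obtain M where M: "\<And>z. z \<in> cbox 0 1 \<times> cball 0 K \<Longrightarrow> \<bar>(\<lambda>(x, p). H x p) z\<bar> \<le> M"
    by (metis (no_types, lifting) compact_imp_bounded bounded_iff imageI real_norm_def)
  have "\<bar>H x p\<bar> \<le> M" if "norm p \<le> K" for x p
    using M[of "(fractional_part x, p)"] that
    by (simp add: fractional_part_cbox periodic_fractional_part[OF per])
  then show thesis by (rule that)
qed

lemma tonelli_uniformly_continuous:
  fixes H :: "real ^ 'n \<Rightarrow> real ^ 'n \<Rightarrow> real"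
  assumes "tonelli_hamiltonian H" "\<epsilon> > 0"
  obtains \<delta> where "\<delta> > 0"
    "\<And>x y p. norm p \<le> K \<Longrightarrow> norm (x - y) < \<delta> \<Longrightarrow> \<bar>H x p - H y p\<bar> < \<epsilon>"
proof -
  have per: "periodic H" using assms by (simp add: tonelli_hamiltonian_def)
  \<comment> \<open>Close points may have distant fractional parts. Both are therefore moved by the
    same integral vector, the one that reduces \<open>x\<close>; the second point then stays in the
    cube enlarged by 1 on every side.\<close>
  define S :: "(real ^ 'n) set" where "S = cbox (- 1) 2"
  have "uniformly_continuous_on (S \<times> cball 0 K) (\<lambda>(x, p). H x p)"
    unfolding S_def
    by (intro compact_uniformly_continuous continuous_on_subset[OF tonelli_continuous[OF assms(1)]]
        compact_Times compact_cbox compact_cball) auto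
  then obtain d where d: "d > 0"
    "\<And>z z'. \<lbrakk>z \<in> S \<times> cball 0 K; z' \<in> S \<times> cball 0 K; dist z' z < d\<rbrakk> \<Longrightarrow>
       dist ((\<lambda>(x, p). H x p) z') ((\<lambda>(x, p). H x p) z) < \<epsilon>"
    using assms(2) unfolding uniformly_continuous_on_def by metis
  have "\<bar>H x p - H y p\<bar> < \<epsilon>" if p: "norm p \<le> K" and xy: "norm (x - y) < min d 1" for x y p
  proof -
    define x' where "x' = fractional_part x"
    define y' where "y' = y + (x' - x)"
    have eq: "H x' p = H x p" "H y' p = H y p"
      using periodic_fractional_part[OF per, of x] periodicD[OF per fractional_part_diff[of x], of y]
      by (simp_all add: x'_def y'_def)
    have diff: "x' - y' = x - y" by (simp add: y'_def)
    have "\<bar>x' $ k - y' $ k\<bar> < 1" for k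
      using component_le_norm_cart[of "x - y" k] xy by (simp flip: diff)
    then have "x' \<in> S" "y' \<in> S"
      using fractional_part_bounds[of x] unfolding x'_def[symmetric] S_def
      by (auto simp: mem_box_cart) (smt (verit))+
    then show ?thesis
      using d(2)[of "(y', p)" "(x', p)"] p xy
      by (simp add: eq dist_Pair_Pair dist_norm diff)
  qed
  then show thesis using that[of "min d 1"] d(1) by auto
qed

section \<open>The Lagrangian\<close>

text \<open>Superlinearity with slope \<open>norm v + 1\<close> beats the linear term. This bound
  makes the real-valued \<open>SUP\<close> in \<open>lagrangian\<close> a genuine supremum.\<close>

lemma lagrangian_bdd_above:
  fixes H :: "real ^ 'n \<Rightarrow> real ^ 'n \<Rightarrow> real"
  assumes "superlinear H"
  shows "bdd_above (range (\<lambda>p. p \<bullet> v - H x p))"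
proof -
  have "norm v + 1 > 0" by (smt (verit) norm_ge_zero)
  then obtain C where C: "\<And>p. H x p \<ge> (norm v + 1) * norm p - C"
    using assms unfolding superlinear_def by blast
  have "p \<bullet> v - H x p \<le> C" for p
    using C[of p] norm_cauchy_schwarz[of p v] norm_ge_zero[of p]
    unfolding distrib_right mult.commute[of "norm v"] by linarith
  then show ?thesis by (auto simp: bdd_above_def)
qed

lemma fenchel:
  assumes "superlinear H"
  shows "p \<bullet> v - H x p \<le> lagrangian H x v"
  unfolding lagrangian_def by (rule cSUP_upper[OF UNIV_I lagrangian_bdd_above[OF assms]])

lemma lagrangian_le:
  assumes "\<And>p. p \<bullet> v - H x p \<le> c"
  shows "lagrangian H x v \<le> c"
  unfolding lagrangian_def by (rule cSUP_least) (use assms in auto)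

lemma lagrangian_bounded_above:
  fixes H :: "real ^ 'n \<Rightarrow> real ^ 'n \<Rightarrow> real"
  assumes "superlinear H"
  obtains C where "\<And>x v. norm v \<le> V \<Longrightarrow> lagrangian H x v \<le> C"
proof -
  obtain C where C: "\<And>x p. H x p \<ge> (\<bar>V\<bar> + 1) * norm p - C"
    using assms unfolding superlinear_def by (metis abs_ge_zero add_nonneg_pos zero_less_one)
  have "lagrangian H x v \<le> C" if "norm v \<le> V" for x v
  proof (rule lagrangian_le)
    fix p :: "real ^ 'n"
    have "norm p * norm v \<le> norm p * V" "norm p * V \<le> norm p * \<bar>V\<bar>"
      using that by (auto intro: mult_left_mono)
    then show "p \<bullet> v - H x p \<le> C"
      using C[of p x] norm_cauchy_schwarz[of p v] norm_ge_zero[of p]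
      unfolding distrib_right mult.commute[of "\<bar>V\<bar>"] by linarith
  qed
  then show thesis by (rule that)
qed

lemma lagrangian_superlinear:
  fixes H :: "real ^ 'n \<Rightarrow> real ^ 'n \<Rightarrow> real"
  assumes "tonelli_hamiltonian H"
  shows "superlinear (lagrangian H)"
  unfolding superlinear_def
proof (intro allI impI)
  fix K :: real assume K: "K > 0"
  have sup: "superlinear H" using assms by (simp add: tonelli_hamiltonian_def)
  obtain M where M: "\<And>x p. norm p \<le> K \<Longrightarrow> \<bar>H x p\<bar> \<le> M"
    using tonelli_bounded[OF assms] by blast
  have "lagrangian H x v \<ge> K * norm v - M" for x v
  proof -
    \<comment> \<open>The momentum of length \<open>K\<close> in the direction of \<open>v\<close>.
      For \<open>v = 0\<close> division by zero yields \<open>p = 0\<close>, and both claims below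
      still hold.\<close>
    define p where "p = (K / norm v) *\<^sub>R v"
    have "norm p \<le> K" "p \<bullet> v = K * norm v"
      using K by (auto simp: p_def dot_square_norm power2_eq_square)
    then show ?thesis using fenchel[OF sup, of p v x] M[of p x] by simp
  qed
  then show "\<exists>C. \<forall>x v. lagrangian H x v \<ge> K * norm v - C" by blast
qed

lemma lagrangian_periodic: "periodic H \<Longrightarrow> periodic (lagrangian H)"
  by (auto simp: periodic_def lagrangian_def fun_eq_iff)

text \<open>Large momenta contribute less than the value at the base point, uniformly for nearby
  \<open>x\<close> and \<open>v\<close>. On the remaining ball of momenta \<open>H\<close> is
  uniformly continuous in \<open>x\<close>, and the linear term varies little with
  \<open>v\<close>.\<close>

lemma lagrangian_upper_semicontinuous:
  fixes H :: "real ^ 'n \<Rightarrow> real ^ 'n \<Rightarrow> real"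
  assumes H: "tonelli_hamiltonian H" and "\<epsilon> > 0"
  obtains \<delta> where "\<delta> > 0"
    "\<And>x v. norm (x - x\<^sub>0) < \<delta> \<Longrightarrow> norm (v - v\<^sub>0) < \<delta> \<Longrightarrow>
       lagrangian H x v < lagrangian H x\<^sub>0 v\<^sub>0 + \<epsilon>"
proof -
  have sup: "superlinear H" using H by (simp add: tonelli_hamiltonian_def)
  define V where "V = norm v\<^sub>0 + 1"
  have "V + 1 > 0" by (simp add: V_def add_pos_nonneg)
  then obtain C where C: "\<And>x p. H x p \<ge> (V + 1) * norm p - C"
    using sup unfolding superlinear_def by blast
  \<comment> \<open>The slope \<open>V + 1\<close> leaves \<open>C - norm p\<close> as a bound on
    the expression in the supremum; beyond \<open>R\<close> this is below the Lagrangian at the base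
    point.\<close>
  define R where "R = \<bar>C - lagrangian H x\<^sub>0 v\<^sub>0\<bar> + 1"
  obtain d where d: "d > 0"
    "\<And>x y p. norm p \<le> R \<Longrightarrow> norm (x - y) < d \<Longrightarrow> \<bar>H x p - H y p\<bar> < \<epsilon> / 4"
    using tonelli_uniformly_continuous[OF H, of "\<epsilon> / 4"] assms(2) by auto
  define \<delta> where "\<delta> = min d (min 1 (\<epsilon> / (4 * R)))"
  have R: "R > 0" by (simp add: R_def)
  have "lagrangian H x v < lagrangian H x\<^sub>0 v\<^sub>0 + \<epsilon>"
    if x: "norm (x - x\<^sub>0) < \<delta>" and v: "norm (v - v\<^sub>0) < \<delta>" for x v
  proof -
    have "lagrangian H x v \<le> lagrangian H x\<^sub>0 v\<^sub>0 + \<epsilon> / 2"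
    proof (rule lagrangian_le)
      fix p
      show "p \<bullet> v - H x p \<le> lagrangian H x\<^sub>0 v\<^sub>0 + \<epsilon> / 2"
      proof (cases "norm p \<le> R")
        case True
        have "p \<bullet> (v - v\<^sub>0) \<le> norm p * norm (v - v\<^sub>0)" by (rule norm_cauchy_schwarz)
        also have "\<dots> \<le> R * (\<epsilon> / (4 * R))"
          using v True by (intro mult_mono) (auto simp: \<delta>_def R_def)
        also have "\<dots> = \<epsilon> / 4" using R by simp
        finally have "p \<bullet> v \<le> p \<bullet> v\<^sub>0 + \<epsilon> / 4" by (simp add: inner_diff_right)
        moreover have "\<bar>H x p - H x\<^sub>0 p\<bar> < \<epsilon> / 4" using d(2) True x by (simp add: \<delta>_def)
        ultimately show ?thesis using fenchel[OF sup, of p v\<^sub>0 x\<^sub>0] by linarith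
      next
        case False
        have "norm v \<le> V"
          using v norm_triangle_sub[of v v\<^sub>0] by (simp add: \<delta>_def V_def)
        then have "p \<bullet> v \<le> norm p * V"
          using norm_cauchy_schwarz[of p v] by (meson mult_left_mono norm_ge_zero order_trans)
        then have "p \<bullet> v - H x p \<le> C - norm p"
          using C[of p x] by (simp add: algebra_simps)
        then show ?thesis using False assms(2) by (simp add: R_def)
      qed
    qed
    then show ?thesis using assms(2) by linarith
  qed
  then show thesis using that[of \<delta>] d(1) R assms(2) by (simp add: \<delta>_def)
qed

text \<open>The equality case of Fenchel's inequality: for a velocity dual to \<open>p\<close> the
  supremum is attained at \<open>p\<close>.\<close>

lemma lagrangian_at_subgradient:
  assumes "\<And>q. H x p + v \<bullet> (q - p) \<le> H x q"
  shows "lagrangian H x v \<le> p \<bullet> v - H x p"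
proof (rule lagrangian_le)
  fix q
  show "q \<bullet> v - H x q \<le> p \<bullet> v - H x p"
    using assms[of q] by (simp add: inner_diff_right inner_commute)
qed

section \<open>The grid and its simplices\<close>

lemma mesh_size_pos: "mesh_size h \<Longrightarrow> h > 0"
  by (auto simp: mesh_size_def)

text \<open>The Euclidean norm is at most the sum of the absolute values of the coordinates. The
  factors \<open>CARD('n)\<close> in later estimates come from here.\<close>

lemma norm_le_card_mult:
  fixes x :: "real ^ 'n"
  assumes "\<And>k. \<bar>x $ k\<bar> \<le> c"
  shows "norm x \<le> real CARD('n) * c"
  using norm_le_l1_cart[of x] sum_bounded_above[of UNIV "\<lambda>k. \<bar>x $ k\<bar>" c] assms by simp

lemma grid_subset_lattice: "grid h \<subseteq> lattice h"
  by (auto simp: grid_def)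

lemma fractional_part_in_grid:
  assumes "mesh_size h" "x \<in> lattice h" shows "fractional_part x \<in> grid h"
proof -
  have "x + (fractional_part x - x) \<in> lattice h"
    using assms lattice_add lattice_1_subset fractional_part_diff by blast
  then show ?thesis using fractional_part_bounds by (auto simp: grid_def)
qed

lemma finite_lattice_Int_bounded:
  fixes S :: "(real ^ 'n) set"
  assumes "h > 0" "bounded S"
  shows "finite (lattice h \<inter> S)"
proof -
  obtain R where R: "\<And>x. x \<in> S \<Longrightarrow> norm x \<le> R" using assms(2) bounded_iff by blast
  define M where "M = \<lceil>R / h\<rceil>"
  have "lattice h \<inter> S \<subseteq> (\<lambda>f. \<chi> k. of_int (f k) * h) ` (UNIV \<rightarrow>\<^sub>E {- M..M})"
  proof
    fix x assume x: "x \<in> lattice h \<inter> S"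
    then obtain f where f: "\<And>k. x $ k = of_int (f k) * h"
      unfolding lattice_def by (auto simp: choice_iff)
    have "f k \<in> {- M..M}" for k
    proof -
      have "\<bar>of_int (f k) * h\<bar> \<le> R"
        using component_le_norm_cart[of x k] R[of x] x by (simp add: f)
      then have "\<bar>real_of_int (f k)\<bar> \<le> R / h"
        using assms(1) by (simp add: abs_mult pos_le_divide_eq)
      then have "\<bar>f k\<bar> \<le> M" unfolding M_def by linarith
      then show ?thesis by auto
    qed
    then show "x \<in> (\<lambda>f. \<chi> k. of_int (f k) * h) ` (UNIV \<rightarrow>\<^sub>E {- M..M})"
      by (intro image_eqI[of _ _ f]) (auto simp: vec_eq_iff f)
  qed
  then show ?thesis by (rule finite_subset) (intro finite_imageI finite_PiE; simp)
qed

lemma finite_grid: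
  assumes "h > 0" shows "finite (grid h :: (real ^ 'n) set)"
proof -
  have "grid h \<subseteq> lattice h \<inter> (cbox 0 1 :: (real ^ 'n) set)"
    by (auto simp: grid_def mem_box_cart less_imp_le)
  then show ?thesis
    using finite_lattice_Int_bounded[OF assms bounded_cbox] finite_subset by blast
qed

section \<open>Rounding to the lattice and comparison with vertices of simplices\<close>

definition lattice_round :: "real \<Rightarrow> real ^ 'n \<Rightarrow> real ^ 'n" where
  "lattice_round h x = (\<chi> k. of_int \<lfloor>x $ k / h\<rfloor> * h)"

lemma lattice_round_in: "lattice_round h x \<in> lattice h"
  by (auto simp: lattice_round_def lattice_def)

lemma lattice_round_id: "h > 0 \<Longrightarrow> x \<in> lattice h \<Longrightarrow> lattice_round h x = x"
proof -
  assume h: "h > 0" and "x \<in> lattice h"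
  then obtain f where f: "\<And>k. x $ k = of_int (f k) * h"
    unfolding lattice_def by (auto simp: choice_iff)
  show ?thesis using h by (simp add: lattice_round_def vec_eq_iff f)
qed

lemma lattice_round_dist:
  fixes x :: "real ^ 'n"
  assumes "h > 0" shows "norm (lattice_round h x - x) \<le> real CARD('n) * h"
proof (rule norm_le_card_mult)
  fix k
  have "of_int \<lfloor>x $ k / h\<rfloor> \<le> x $ k / h" "x $ k / h \<le> of_int \<lfloor>x $ k / h\<rfloor> + 1"
    by linarith+
  then have "of_int \<lfloor>x $ k / h\<rfloor> * h \<le> x $ k" "x $ k \<le> (of_int \<lfloor>x $ k / h\<rfloor> + 1) * h"
    using assms by (simp_all only: pos_le_divide_eq pos_divide_le_eq)
  then show "\<bar>(lattice_round h x - x) $ k\<bar> \<le> h"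
    by (simp add: lattice_round_def algebra_simps)
qed

text \<open>Otherwise all extreme points lie in an open half-space that misses \<open>x\<close>.
  Their convex hull lies there too, but by Krein-Milman it is all of \<open>T\<close>.\<close>

lemma extreme_point_above:
  fixes a :: "'a::euclidean_space"
  assumes "compact T" "convex T" "x \<in> T"
  obtains p where "p extreme_point_of T" "a \<bullet> x \<le> a \<bullet> p"
proof (rule ccontr)
  assume "\<not> thesis"
  then have "{p. p extreme_point_of T} \<subseteq> {p. a \<bullet> p < a \<bullet> x}"
    using that by force
  then have "convex hull {p. p extreme_point_of T} \<subseteq> {p. a \<bullet> p < a \<bullet> x}"
    by (simp add: convex_halfspace_lt hull_minimal)
  then show False using Krein_Milman_Minkowski[OF assms(1,2)] assms(3) by blast
qed

text \<open>An affine function on a simplex is dominated by its value at some vertex, and the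
  simplex lies in one grid cube. Lattice estimates thus pass to arbitrary points without barycentric
  coordinates.\<close>

lemma pw_affine_vertex_above:
  fixes w :: "real ^ 'n \<Rightarrow> real"
  assumes "grid_triangulation h \<T>"
    and "\<And>T. T \<in> \<T> \<Longrightarrow> \<exists>a b. \<forall>x \<in> T. w x = a \<bullet> x + b"
  obtains p where "p \<in> lattice h" "norm (p - x) \<le> real CARD('n) * h" "w x \<le> w p"
proof -
  have "x \<in> \<Union>\<T>" and "\<forall>T \<in> \<T>. int CARD('n) simplex T \<and>
      {x. x extreme_point_of T} \<subseteq> lattice h \<and> (\<exists>z \<in> lattice h. T \<subseteq> cbox z (z + (\<chi> k. h)))"
    using assms(1) unfolding grid_triangulation_def by simp_all
  then obtain T z where T: "T \<in> \<T>" "x \<in> T" and splx: "int CARD('n) simplex T"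
    and vert: "{x. x extreme_point_of T} \<subseteq> lattice h" and z: "T \<subseteq> cbox z (z + (\<chi> k. h))"
    by (metis UnionE)
  obtain a b where ab: "\<And>x. x \<in> T \<Longrightarrow> w x = a \<bullet> x + b"
    using assms(2)[OF T(1)] by blast
  obtain p where p: "p extreme_point_of T" "a \<bullet> x \<le> a \<bullet> p"
    by (rule extreme_point_above[OF compact_simplex[OF splx] convex_simplex[OF splx] T(2)])
  have "p \<in> T" using p(1) by (simp add: extreme_point_of_def)
  have "norm (p - x) \<le> real CARD('n) * h"
  proof (rule norm_le_card_mult)
    fix k
    have "p \<in> cbox z (z + (\<chi> k. h))" "x \<in> cbox z (z + (\<chi> k. h))"
      using z \<open>p \<in> T\<close> T(2) by auto
    then show "\<bar>(p - x) $ k\<bar> \<le> h" 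
      by (smt (verit) mem_box_cart vector_add_component vec_lambda_beta vector_minus_component)
  qed
  then show thesis using that[of p] vert p ab \<open>p \<in> T\<close> T(2) by auto
qed

lemma pw_affine_vertex_below:
  fixes w :: "real ^ 'n \<Rightarrow> real"
  assumes "grid_triangulation h \<T>"
    and "\<And>T. T \<in> \<T> \<Longrightarrow> \<exists>a b. \<forall>x \<in> T. w x = a \<bullet> x + b"
  obtains p where "p \<in> lattice h" "norm (p - x) \<le> real CARD('n) * h" "w p \<le> w x"
proof -
  have "\<exists>a b. \<forall>x \<in> T. - w x = a \<bullet> x + b" if "T \<in> \<T>" for T
  proof -
    obtain a b where "\<forall>x \<in> T. w x = a \<bullet> x + b" using assms(2) \<open>T \<in> \<T>\<close> by blast
    then have "\<forall>x \<in> T. - w x = (- a) \<bullet> x + (- b)" by simp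
    then show ?thesis by blast
  qed
  from pw_affine_vertex_above[OF assms(1) this, of x] that show thesis by auto
qed

section \<open>The discrete equation on the full lattice\<close>

text \<open>The discrete equation unfolded from the torus to $h Z^d$. Since
  \<open>lax_oleinik\<close> is an infimum, it is stated in two halves: a lower bound, and its
  approximation up to any \<open>\<eta>\<close>.\<close>

definition lattice_solution ::
  "(real ^ 'n \<Rightarrow> real ^ 'n \<Rightarrow> real) \<Rightarrow> real \<Rightarrow> real \<Rightarrow> real \<Rightarrow> (real ^ 'n \<Rightarrow> real) \<Rightarrow> bool" where
  "lattice_solution L h \<tau> c w \<longleftrightarrow> periodic w \<and>
     (\<forall>x \<in> lattice h. \<forall>y \<in> lattice h. w y + \<tau> * c \<le> w x + \<tau> * L x ((y - x) /\<^sub>R \<tau>)) \<and>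
     (\<forall>y \<in> lattice h. \<forall>\<eta>>0. \<exists>x \<in> lattice h.
        w x + \<tau> * L x ((y - x) /\<^sub>R \<tau>) < w y + \<tau> * c + \<eta>)"

text \<open>A pair of a grid point \<open>x\<close> and an integral vector \<open>l\<close> encodes
  the lattice point \<open>x - l\<close>. By periodicity of \<open>w\<close> and \<open>L\<close>,
  minimizing over pairs is minimizing over the whole lattice.\<close>

lemma lattice_solutionI:
  fixes L :: "real ^ 'n \<Rightarrow> real ^ 'n \<Rightarrow> real"
  assumes h: "mesh_size h" and \<tau>: "\<tau> > 0"
    and L: "superlinear L" "periodic L"
    and w: "periodic w" "\<And>x. x \<in> grid h \<Longrightarrow> w x = u x"
    and sol: "discrete_solution L h \<tau> c u"
  shows "lattice_solution L h \<tau> c w"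
  unfolding lattice_solution_def
proof (intro conjI ballI allI impI)
  show "periodic w" by fact
  let ?F = "\<lambda>y (x, l). u x + \<tau> * L x ((y + l - x) /\<^sub>R \<tau>)"
  have fin: "finite (grid h :: (real ^ 'n) set)" using finite_grid mesh_size_pos h by blast
  \<comment> \<open>\<open>L\<close> is bounded below by superlinearity and \<open>u\<close> by
    finiteness of the grid, so the \<open>INF\<close> in the operator is a genuine infimum.\<close>
  obtain C where C: "\<And>x v. L x v \<ge> 1 * norm v - C"
    using L(1) unfolding superlinear_def by (meson zero_less_one)
  obtain m where m: "\<And>x. x \<in> grid h \<Longrightarrow> m \<le> u x"
    using bdd_below_finite[OF finite_imageI[OF fin, of u]] by (auto simp: bdd_below_def)
  have "m - \<tau> * C \<le> ?F y z" if "z \<in> grid h \<times> lattice 1" for y z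
  proof -
    have "- C \<le> L (fst z) v" for v using C[where v = v and x = "fst z"] norm_ge_zero[of v] by linarith
    then have "\<tau> * (- C) \<le> \<tau> * L (fst z) ((y + snd z - fst z) /\<^sub>R \<tau>)"
      using \<tau> by (intro mult_left_mono) auto
    moreover have "m \<le> u (fst z)" using m that by auto
    ultimately show ?thesis by (simp add: case_prod_beta)
  qed
  then have bdd: "bdd_below (?F y ` (grid h \<times> lattice 1))" for y
    by (intro bdd_belowI2)
  have wu: "w x = u (fractional_part x)" if "x \<in> lattice h" for x
    using w(2)[OF fractional_part_in_grid[OF h that]] periodic_fractional_part[OF w(1)] by metis
  have value_eq: "w y + \<tau> * c = (INF z \<in> grid h \<times> lattice 1. ?F (fractional_part y) z)"
    if "y \<in> lattice h" for y
    using sol fractional_part_in_grid[OF h that] wu[OF that]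
    unfolding discrete_solution_def lax_oleinik_def by simp
  show "w y + \<tau> * c \<le> w x + \<tau> * L x ((y - x) /\<^sub>R \<tau>)" if x: "x \<in> lattice h" and y: "y \<in> lattice h"
    for x y
  proof -
    \<comment> \<open>Chosen so that the displacement between the reduced points, corrected by
      \<open>l\<close>, is exactly \<open>y - x\<close>.\<close>
    define l where "l = (fractional_part x - x) - (fractional_part y - y)"
    have "l \<in> lattice 1" unfolding l_def by (intro lattice_diff fractional_part_diff)
    then have "w y + \<tau> * c \<le> ?F (fractional_part y) (fractional_part x, l)"
      unfolding value_eq[OF y]
      by (intro cINF_lower[OF bdd]) (use fractional_part_in_grid[OF h x] in auto)
    also have "\<dots> = w x + \<tau> * L x ((y - x) /\<^sub>R \<tau>)"
      using wu[OF x] periodic_fractional_part[OF L(2), of x] by (simp add: l_def)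
    finally show ?thesis .
  qed
  show "\<exists>x \<in> lattice h. w x + \<tau> * L x ((y - x) /\<^sub>R \<tau>) < w y + \<tau> * c + \<eta>"
    if y: "y \<in> lattice h" and "\<eta> > 0" for y \<eta>
  proof -
    have ne: "grid h \<times> lattice 1 \<noteq> ({} :: ((real ^ 'n) \<times> (real ^ 'n)) set)"
      using fractional_part_in_grid[OF h y] fractional_part_diff by blast
    have "Inf (?F (fractional_part y) ` (grid h \<times> lattice 1)) < w y + \<tau> * c + \<eta>"
      using value_eq[OF y] \<open>\<eta> > 0\<close> by simp
    then obtain z where z: "z \<in> grid h \<times> lattice 1" "?F (fractional_part y) z < w y + \<tau> * c + \<eta>"
      using cInf_lessD[of "?F (fractional_part y) ` (grid h \<times> lattice 1)"] ne by blast
    obtain g l where gl: "z = (g, l)" "g \<in> grid h" "l \<in> lattice 1" using z(1) by auto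
    \<comment> \<open>Conversely, moving the grid point \<open>g\<close> by \<open>- t\<close> turns
      the displacement to the reduced point into the one to \<open>y\<close> itself.\<close>
    define t where "t = l + (fractional_part y - y)"
    have t: "t \<in> lattice 1" unfolding t_def using gl by (intro lattice_add fractional_part_diff)
    have x: "g - t \<in> lattice h"
      using lattice_diff[of g h t] t gl(2) lattice_1_subset[OF h] by (auto simp: grid_def)
    have "w (g - t) = u g" "L (g - t) = L g"
      using w(2)[OF gl(2)] periodic_cong_lattice[OF w(1), of g "g - t"]
        periodic_cong_lattice[OF L(2), of g "g - t"] t by simp_all
    moreover have "y - (g - t) = fractional_part y + l - g" by (simp add: t_def)
    ultimately show ?thesis using z(2) x gl(1) by (intro bexI[of _ "g - t"]) (simp_all only: prod.case)
  qed
qed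

section \<open>A priori estimates and compactness\<close>

lemma lattice_solution_upper:
  "\<lbrakk>lattice_solution L h \<tau> c w; x \<in> lattice h; y \<in> lattice h\<rbrakk> \<Longrightarrow>
     w y + \<tau> * c \<le> w x + \<tau> * L x ((y - x) /\<^sub>R \<tau>)"
  by (simp add: lattice_solution_def)

lemma lattice_solution_approx:
  assumes "lattice_solution L h \<tau> c w" "y \<in> lattice h" "\<eta> > 0"
  obtains x where "x \<in> lattice h" "w x + \<tau> * L x ((y - x) /\<^sub>R \<tau>) < w y + \<tau> * c + \<eta>"
  using assms unfolding lattice_solution_def by blast

text \<open>Staying at one point with velocity 0 bounds \<open>c\<close> from above. At a minimum of
  \<open>w\<close> a near-optimal predecessor has no smaller value, so the cost of the step bounds
  \<open>c\<close> from below.\<close>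

lemma lattice_solution_eigenvalue_bounds:
  fixes w :: "real ^ 'n \<Rightarrow> real"
  assumes sol: "lattice_solution L h \<tau> c w" and h: "mesh_size h" and "\<tau> > 0"
    and lower: "\<And>x v. a \<le> L x v" and upper: "\<And>x. L x 0 \<le> b"
  shows "a \<le> c" "c \<le> b"
proof -
  have per: "periodic w" using sol by (simp add: lattice_solution_def)
  have "0 \<in> lattice h" by (auto simp: lattice_def intro: exI[of _ 0])
  then have "\<tau> * c \<le> \<tau> * L 0 0" using lattice_solution_upper[OF sol, of 0 0] by simp
  then show "c \<le> b" using upper[of 0] \<open>\<tau> > 0\<close> by simp
  have fin: "finite (w ` grid h)" using finite_grid[OF mesh_size_pos[OF h]] by blast
  have "fractional_part 0 \<in> grid h" using fractional_part_in_grid[OF h \<open>0 \<in> lattice h\<close>] .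
  then obtain y where y: "y \<in> grid h" "w y = Min (w ` grid h)"
    using Min_in[OF fin] by fastforce
  have min: "w y \<le> w x" if "x \<in> lattice h" for x
    using fractional_part_in_grid[OF h that] periodic_fractional_part[OF per, of x] Min_le[OF fin] y(2)
    by (metis imageI)
  have "\<tau> * a \<le> \<tau> * c + \<eta>" if "\<eta> > 0" for \<eta>
  proof -
    obtain x where x: "x \<in> lattice h" "w x + \<tau> * L x ((y - x) /\<^sub>R \<tau>) < w y + \<tau> * c + \<eta>"
      using lattice_solution_approx[OF sol _ \<open>\<eta> > 0\<close>] y(1) grid_subset_lattice by blast
    have "\<tau> * a \<le> \<tau> * L x ((y - x) /\<^sub>R \<tau>)" using \<open>\<tau> > 0\<close> lower by simp
    then show ?thesis using x(2) min[OF x(1)] by linarith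
  qed
  then have "\<tau> * a \<le> \<tau> * c" by (rule field_le_epsilon)
  then show "a \<le> c" using \<open>\<tau> > 0\<close> by simp
qed

text \<open>A lattice path follows the segment from \<open>x\<close> to \<open>y\<close> in steps of
  duration \<open>\<tau>\<close>, each raising \<open>w\<close> by at most
  \<open>\<tau> * A\<close>. A piece of length at most \<open>\<tau>\<close> with both ends rounded
  has velocity at most \<open>1 + 2 * real CARD('n) * B\<close>, because
  \<open>h \<le> B * \<tau>\<close>.\<close>

lemma lattice_solution_almost_lipschitz:
  fixes w :: "real ^ 'n \<Rightarrow> real"
  assumes sol: "lattice_solution L h \<tau> c w" and "h > 0" and "\<tau> > 0"
    and hB: "h \<le> B * \<tau>"
    and upper: "\<And>x v. norm v \<le> 1 + 2 * real CARD('n) * B \<Longrightarrow> L x v \<le> C"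
    and A: "C - c \<le> A" "0 \<le> A"
    and x: "x \<in> lattice h" and y: "y \<in> lattice h"
  shows "w y - w x \<le> A * (norm (y - x) + \<tau>)"
proof -
  let ?V = "1 + 2 * real CARD('n) * B" and ?r = "lattice_round h"
  have step: "w y - w x \<le> \<tau> * A"
    if "x \<in> lattice h" "y \<in> lattice h" "norm (y - x) \<le> ?V * \<tau>" for x y
  proof -
    have "norm ((y - x) /\<^sub>R \<tau>) \<le> ?V"
      using that(3) \<open>\<tau> > 0\<close>
      by (simp add: divide_inverse[symmetric] mult.commute[of "inverse \<tau>"] pos_divide_le_eq)
    then have "L x ((y - x) /\<^sub>R \<tau>) \<le> A + c" using upper[of "(y - x) /\<^sub>R \<tau>" x] A(1) by linarith
    then have "\<tau> * L x ((y - x) /\<^sub>R \<tau>) \<le> \<tau> * (A + c)" using \<open>\<tau> > 0\<close> by simp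
    then show ?thesis using lattice_solution_upper[OF sol that(1,2)] by (simp add: algebra_simps)
  qed
  \<comment> \<open>The induction runs over points \<open>y\<close> off the lattice and rounds only
    at the end, so rounding errors do not accumulate.\<close>
  have chain: "w (?r y) - w x \<le> real m * (\<tau> * A)" if "norm (y - x) \<le> real m * \<tau>" for m y
    using that
  proof (induction m arbitrary: y)
    case 0
    then show ?case using lattice_round_id[OF \<open>h > 0\<close> x] by simp
  next
    case (Suc m)
    \<comment> \<open>Dividing the segment in the ratio \<open>m\<close> to 1 leaves a last piece of
      length at most \<open>\<tau>\<close>.\<close>
    define y' where "y' = x + (real m / real (Suc m)) *\<^sub>R (y - x)"
    have "norm (y' - x) = real m / real (Suc m) * norm (y - x)"
      by (simp add: y'_def)
    also have "\<dots> \<le> real m / real (Suc m) * (real (Suc m) * \<tau>)"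
      by (intro mult_left_mono Suc.prems) simp
    finally have y'x: "norm (y' - x) \<le> real m * \<tau>" by simp
    have "y - y' = (1 - real m / real (Suc m)) *\<^sub>R (y - x)"
      by (simp add: y'_def algebra_simps)
    also have "1 - real m / real (Suc m) = 1 / real (Suc m)" by (simp add: field_simps)
    finally have "norm (y - y') = norm (y - x) / real (Suc m)" by simp
    then have "norm (y - y') \<le> \<tau>"
      using Suc.prems by (simp add: pos_divide_le_eq mult.commute del: of_nat_Suc)
    moreover have "norm (?r y - ?r y') \<le> norm (?r y - y) + norm (y - y') + norm (?r y' - y')"
      using norm_triangle_ineq[of "?r y - y" "y - y'"]
        norm_triangle_ineq4[of "(?r y - y) + (y - y')" "?r y' - y'"] by simp
    moreover note lattice_round_dist[OF \<open>h > 0\<close>, of y] lattice_round_dist[OF \<open>h > 0\<close>, of y']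
    moreover have "real CARD('n) * h \<le> real CARD('n) * (B * \<tau>)" using hB by (simp add: mult_left_mono)
    moreover have "?V * \<tau> = \<tau> + 2 * (real CARD('n) * (B * \<tau>))" by (simp add: algebra_simps)
    ultimately have "norm (?r y - ?r y') \<le> ?V * \<tau>" by linarith
    then have "w (?r y) - w (?r y') \<le> \<tau> * A" by (intro step lattice_round_in)
    then show ?case using Suc.IH[OF y'x] by (simp add: algebra_simps)
  qed
  \<comment> \<open>Rounding the number of steps up costs at most one step, the source of the extra
    \<open>\<tau>\<close> in the estimate.\<close>
  define m where "m = nat \<lceil>norm (y - x) / \<tau>\<rceil>"
  have "0 \<le> norm (y - x) / \<tau>" using \<open>\<tau> > 0\<close> by simp
  then have m: "norm (y - x) / \<tau> \<le> real m" "real m \<le> norm (y - x) / \<tau> + 1"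
    unfolding m_def by linarith+
  have "w y - w x \<le> real m * (\<tau> * A)"
    using chain[of y m] m(1) \<open>\<tau> > 0\<close> lattice_round_id[OF \<open>h > 0\<close> y] by (simp add: pos_divide_le_eq)
  also have "\<dots> \<le> (norm (y - x) / \<tau> + 1) * (\<tau> * A)"
    using m(2) A(2) \<open>\<tau> > 0\<close> by (intro mult_right_mono) auto
  also have "\<dots> = A * (norm (y - x) + \<tau>)" using \<open>\<tau> > 0\<close> by (simp add: field_simps)
  finally show ?thesis .
qed

lemma pw_affine_almost_lipschitz:
  fixes w :: "real ^ 'n \<Rightarrow> real"
  assumes tri: "grid_triangulation h \<T>"
    and aff: "\<And>T. T \<in> \<T> \<Longrightarrow> \<exists>a b. \<forall>x \<in> T. w x = a \<bullet> x + b"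
    and est: "\<And>x y. \<lbrakk>x \<in> lattice h; y \<in> lattice h\<rbrakk> \<Longrightarrow> w y - w x \<le> A * (norm (y - x) + \<tau>)"
    and "0 \<le> A"
  shows "\<bar>w y - w x\<bar> \<le> A * (norm (y - x) + (2 * real CARD('n) * h + \<tau>))"
proof -
  have *: "w y - w x \<le> A * (norm (y - x) + (2 * real CARD('n) * h + \<tau>))" for x y
  proof -
    obtain q where q: "q \<in> lattice h" "norm (q - y) \<le> real CARD('n) * h" "w y \<le> w q"
      using pw_affine_vertex_above[OF tri aff] by blast
    obtain p where p: "p \<in> lattice h" "norm (p - x) \<le> real CARD('n) * h" "w p \<le> w x"
      using pw_affine_vertex_below[OF tri aff] by blast
    have "norm (q - p) \<le> norm (q - y) + norm (y - x) + norm (p - x)"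
      using norm_triangle_ineq[of "q - y" "y - x"]
        norm_triangle_ineq4[of "(q - y) + (y - x)" "p - x"] by simp
    then have "norm (q - p) + \<tau> \<le> norm (y - x) + (2 * real CARD('n) * h + \<tau>)"
      using p(2) q(2) by simp
    then have "A * (norm (q - p) + \<tau>) \<le> A * (norm (y - x) + (2 * real CARD('n) * h + \<tau>))"
      using \<open>0 \<le> A\<close> by (rule mult_left_mono)
    then show ?thesis using est[OF p(1) q(1)] p(3) q(3) by linarith
  qed
  show ?thesis using *[of y x] *[of x y] by (simp add: norm_minus_commute abs_le_iff)
qed

text \<open>Arzela-Ascoli on the unit cube. The error \<open>\<epsilon> n\<close> is small for all
  but finitely many \<open>n\<close>, and those are handled by their own continuity; in the limit
  the error vanishes and the bound becomes a Lipschitz estimate.\<close>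

lemma almost_lipschitz_convergent_subsequence:
  fixes w :: "nat \<Rightarrow> real ^ 'n \<Rightarrow> real"
  assumes per: "\<And>n. periodic (w n)" and cont: "\<And>n. continuous_on UNIV (w n)"
    and est: "\<And>n x y. \<bar>w n y - w n x\<bar> \<le> A * (norm (y - x) + \<epsilon> n)" and "0 \<le> A"
    and \<epsilon>: "\<epsilon> \<longlonglongrightarrow> 0" and zero: "\<And>n. \<exists>x. w n x = 0"
  obtains r v where "strict_mono (r :: nat \<Rightarrow> nat)" "periodic v" "A-lipschitz_on UNIV v"
    "uniform_limit UNIV (\<lambda>n. w (r n)) v sequentially"
proof -
  obtain E where E: "\<And>n. \<bar>\<epsilon> n\<bar> \<le> E"
    using convergent_imp_Bseq[OF convergentI[OF \<epsilon>]] by (auto simp: Bseq_def)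
  have bound: "norm (w n x) \<le> A * (real CARD('n) + E)" if "x \<in> cbox 0 1" for n x
  proof -
    obtain z where "w n z = 0" using zero by blast
    then have "w n (fractional_part z) = 0" by (simp add: periodic_fractional_part[OF per])
    moreover have "norm (x - fractional_part z) \<le> real CARD('n) * 1"
    proof (rule norm_le_card_mult)
      fix k show "\<bar>(x - fractional_part z) $ k\<bar> \<le> 1"
        using that fractional_part_bounds[of z k] by (auto simp: mem_box_cart) (smt (verit))
    qed
    ultimately have "\<bar>w n x\<bar> \<le> A * (norm (x - fractional_part z) + \<epsilon> n)"
      "norm (x - fractional_part z) + \<epsilon> n \<le> real CARD('n) + E"
      using est[where n = n and y = x and x = "fractional_part z"] E[of n] by auto
    then show ?thesis using mult_left_mono[OF _ \<open>0 \<le> A\<close>] by fastforce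
  qed
  have equicont: "\<exists>d>0. \<forall>n y. y \<in> cbox 0 1 \<and> norm (x - y) < d \<longrightarrow> norm (w n x - w n y) < e"
    if "x \<in> cbox 0 1" "0 < e" for x e
  proof -
    have pos: "0 < e / (2 * (A + 1))" using \<open>0 < e\<close> \<open>0 \<le> A\<close> by simp
    have half: "e / (A + 1) = 2 * (e / (2 * (A + 1)))" using \<open>0 \<le> A\<close> by (simp add: field_simps)
    from pos obtain N where N: "\<And>n. n \<ge> N \<Longrightarrow> \<bar>\<epsilon> n\<bar> < e / (2 * (A + 1))"
      using LIMSEQ_D[OF \<epsilon>] by auto
    have "\<forall>n. \<exists>d>0. \<forall>y. norm (x - y) < d \<longrightarrow> norm (w n x - w n y) < e"
      using cont \<open>0 < e\<close> unfolding continuous_on_iff dist_norm by (metis UNIV_I norm_minus_commute)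
    then obtain d where d: "\<And>n. d n > 0" "\<And>n y. norm (x - y) < d n \<Longrightarrow> norm (w n x - w n y) < e"
      by metis
    \<comment> \<open>One radius for all indices: the Lipschitz scale for the tail, individual
      moduli for the first \<open>N\<close> functions. \<open>A + 1\<close> keeps the denominator
      positive when \<open>A = 0\<close>.\<close>
    define D where "D = Min (insert (e / (2 * (A + 1))) (d ` {..<N}))"
    have D: "D > 0" "D \<le> e / (2 * (A + 1))" "\<And>n. n < N \<Longrightarrow> D \<le> d n"
      unfolding D_def using pos d(1) by auto
    have "norm (w n x - w n y) < e" if "norm (x - y) < D" for n y
    proof (cases "n < N")
      case True
      then show ?thesis using d(2) D(3) that by force
    next
      case False
      then have "\<bar>\<epsilon> n\<bar> < e / (2 * (A + 1))" using N by simp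
      then have "norm (x - y) + \<epsilon> n \<le> 2 * (e / (2 * (A + 1)))"
        using that D(2) by linarith
      then have "norm (x - y) + \<epsilon> n \<le> e / (A + 1)" using half by simp
      then have "A * (norm (x - y) + \<epsilon> n) \<le> A * (e / (A + 1))"
        using \<open>0 \<le> A\<close> by (rule mult_left_mono)
      also have "\<dots> < e" using \<open>0 < e\<close> \<open>0 \<le> A\<close> by (simp add: field_simps)
      finally show ?thesis using est[where n = n and y = x and x = y] by simp
    qed
    then show ?thesis using D(1) by blast
  qed
  obtain g and r :: "nat \<Rightarrow> nat" where r: "strict_mono r"
    and lim: "\<And>e. 0 < e \<Longrightarrow> \<exists>N. \<forall>n x. n \<ge> N \<and> x \<in> cbox 0 1 \<longrightarrow> norm (w (r n) x - g x) < e"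
    using Arzela_Ascoli[of "cbox 0 1" w, OF compact_cbox bound equicont] by metis
  \<comment> \<open>\<open>g\<close> is controlled on the cube only; its values there are extended
    periodically.\<close>
  define v where "v x = g (fractional_part x)" for x
  have unif: "uniform_limit UNIV (\<lambda>n. w (r n)) v sequentially"
  proof (rule uniform_limitI)
    fix e :: real assume "e > 0"
    then obtain N where "\<forall>n x. n \<ge> N \<and> x \<in> cbox 0 1 \<longrightarrow> norm (w (r n) x - g x) < e"
      using lim by blast
    then have "dist (w (r n) x) (v x) < e" if "n \<ge> N" for n x
      using that fractional_part_cbox[of x] periodic_fractional_part[OF per, of "r n" x]
      by (metis dist_norm v_def)
    then show "\<forall>\<^sub>F n in sequentially. \<forall>x\<in>UNIV. dist (w (r n) x) (v x) < e"
      by (auto simp: eventually_sequentially)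
  qed
  have "A-lipschitz_on UNIV v"
  proof (rule lipschitz_onI[OF _ \<open>0 \<le> A\<close>])
    fix x y :: "real ^ 'n"
    have "(\<lambda>n. w (r n) x) \<longlonglongrightarrow> v x" "(\<lambda>n. w (r n) y) \<longlonglongrightarrow> v y"
      using tendsto_uniform_limitI[OF unif] by blast+
    then have "(\<lambda>n. \<bar>w (r n) x - w (r n) y\<bar>) \<longlonglongrightarrow> \<bar>v x - v y\<bar>"
      by (intro tendsto_intros)
    moreover have "(\<lambda>n. A * (norm (x - y) + \<epsilon> (r n))) \<longlonglongrightarrow> A * (norm (x - y) + 0)"
      using LIMSEQ_subseq_LIMSEQ[OF \<epsilon> r] by (intro tendsto_intros) (simp add: o_def)
    ultimately have "\<bar>v x - v y\<bar> \<le> A * (norm (x - y) + 0)"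
      by (rule LIMSEQ_le) (use est in blast)
    then show "dist (v x) (v y) \<le> A * dist x y" by (simp add: dist_norm)
  qed
  moreover have "periodic v" by (simp add: periodic_def v_def fractional_part_add)
  ultimately show thesis using that r unif by blast
qed

section \<open>Passage to the limit\<close>

lemma GDERIV_dist_square: "GDERIV (\<lambda>y. (norm (y - x))\<^sup>2) y :> 2 *\<^sub>R (y - x)"
  for x y :: "'a::real_inner"
proof -
  have "((\<lambda>y. (y - x) \<bullet> (y - x)) has_derivative
      (\<lambda>d. (y - x) \<bullet> (d - 0) + (d - 0) \<bullet> (y - x))) (at y)"
    by (intro derivative_intros)
  then show ?thesis
    unfolding gderiv_def power2_norm_eq_inner
    by (rule has_derivative_eq_rhs) (simp add: fun_eq_iff inner_commute)
qed

lemma gradient_mean_value: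
  fixes \<psi> :: "'a::real_inner \<Rightarrow> real"
  assumes "\<And>x. GDERIV \<psi> x :> D\<psi> x"
  obtains \<xi> where "norm (\<xi> - y) \<le> norm (x - y)" "\<psi> x - \<psi> y = D\<psi> \<xi> \<bullet> (x - y)"
proof -
  have line: "((\<lambda>t. y + t *\<^sub>R (x - y)) has_derivative (\<lambda>s. s *\<^sub>R (x - y))) (at t)" for t
    by (auto intro!: derivative_eq_intros)
  have "((\<lambda>t. \<psi> (y + t *\<^sub>R (x - y))) has_real_derivative D\<psi> (y + t *\<^sub>R (x - y)) \<bullet> (x - y)) (at t)" for t
    using diff_chain_at[OF line assms[unfolded gderiv_def]]
    unfolding has_field_derivative_def o_def
    by (rule has_derivative_eq_rhs) (auto simp: inner_commute)
  then obtain t where t: "0 < t" "t < 1"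
    "\<psi> (y + 1 *\<^sub>R (x - y)) - \<psi> (y + 0 *\<^sub>R (x - y)) = (1 - 0) * (D\<psi> (y + t *\<^sub>R (x - y)) \<bullet> (x - y))"
    using MVT2[of 0 1 "\<lambda>t. \<psi> (y + t *\<^sub>R (x - y))"
        "\<lambda>t. D\<psi> (y + t *\<^sub>R (x - y)) \<bullet> (x - y)"] by auto
  have "t * norm (x - y) \<le> 1 * norm (x - y)" using t by (intro mult_right_mono) auto
  then show thesis using that[of "y + t *\<^sub>R (x - y)"] t by simp
qed

text \<open>The limit has a strict maximum with quadratic decay. Comparing a maximizer of
  \<open>f n\<close> over lattice points in the ball with the rounding of \<open>x\<^sub>0\<close>
  forces its distance to \<open>x\<^sub>0\<close> to 0.\<close>

lemma lattice_maxima_converge: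
  fixes f :: "nat \<Rightarrow> real ^ 'n \<Rightarrow> real"
  assumes "\<And>n. h n > 0" "h \<longlonglongrightarrow> 0" "r > 0"
    and unif: "uniform_limit UNIV f g sequentially" and cont: "isCont g x\<^sub>0"
    and strict: "\<And>x. x \<in> cball x\<^sub>0 r \<Longrightarrow> g x \<le> g x\<^sub>0 - (norm (x - x\<^sub>0))\<^sup>2"
  obtains X where "X \<longlonglongrightarrow> x\<^sub>0" "\<forall>\<^sub>F n in sequentially. X n \<in> lattice (h n)"
    "\<forall>\<^sub>F n in sequentially. \<forall>y \<in> lattice (h n) \<inter> cball x\<^sub>0 r. f n y \<le> f n (X n)"
proof -
  define S where "S n = lattice (h n) \<inter> cball x\<^sub>0 r" for n
  define Y where "Y n = lattice_round (h n) x\<^sub>0" for n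
  have "\<exists>x. S n \<noteq> {} \<longrightarrow> x \<in> S n \<and> (\<forall>y \<in> S n. f n y \<le> f n x)" for n
  proof (cases "S n = {}")
    case False
    have fin: "finite (f n ` S n)"
      unfolding S_def using finite_lattice_Int_bounded[OF assms(1) bounded_cball] by blast
    obtain x where x: "x \<in> S n" "f n x = Max (f n ` S n)"
      using Max_in[OF fin] False by fastforce
    have "f n y \<le> f n x" if "y \<in> S n" for y using x Max_ge[OF fin] that by simp
    then show ?thesis using x by blast
  qed simp
  then obtain X where X: "\<And>n. S n \<noteq> {} \<Longrightarrow> X n \<in> S n"
    "\<And>n y. S n \<noteq> {} \<Longrightarrow> y \<in> S n \<Longrightarrow> f n y \<le> f n (X n)"
    by metis
  have "(\<lambda>n. real CARD('n) * h n) \<longlonglongrightarrow> 0"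
    by (rule tendsto_mult_right_zero[OF assms(2)])
  then have "(\<lambda>n. Y n - x\<^sub>0) \<longlonglongrightarrow> 0"
    by (rule Lim_null_comparison[OF always_eventually, rotated])
      (simp add: Y_def lattice_round_dist assms(1))
  then have Y: "Y \<longlonglongrightarrow> x\<^sub>0" by (rule LIM_zero_cancel)
  have Y_S: "\<forall>\<^sub>F n in sequentially. Y n \<in> S n"
    using tendstoD[OF Y \<open>r > 0\<close>]
    by eventually_elim (auto simp: S_def Y_def lattice_round_in dist_commute)
  have "X \<longlonglongrightarrow> x\<^sub>0"
  proof (rule tendstoI)
    fix d :: real assume "d > 0"
    \<comment> \<open>Three errors enter, two from uniform convergence and one from continuity of
      \<open>g\<close>. They sum to less than \<open>d\<^sup>2\<close>.\<close>
    then have e: "d\<^sup>2 / 4 > 0" by simp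
    have gY: "(\<lambda>n. g (Y n)) \<longlonglongrightarrow> g x\<^sub>0" using isCont_tendsto_compose[OF cont Y] .
    show "\<forall>\<^sub>F n in sequentially. dist (X n) x\<^sub>0 < d"
      using Y_S uniform_limitD[OF unif e] tendstoD[OF gY e]
    proof eventually_elim
      case (elim n)
      have "X n \<in> S n" "f n (Y n) \<le> f n (X n)" using X elim(1) by blast+
      moreover have "g (X n) \<le> g x\<^sub>0 - (norm (X n - x\<^sub>0))\<^sup>2"
        using strict \<open>X n \<in> S n\<close> by (simp add: S_def)
      moreover have "\<bar>f n (X n) - g (X n)\<bar> < d\<^sup>2 / 4" "\<bar>f n (Y n) - g (Y n)\<bar> < d\<^sup>2 / 4"
        "\<bar>g (Y n) - g x\<^sub>0\<bar> < d\<^sup>2 / 4"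
        using elim(2,3) by (auto simp: dist_norm)
      ultimately have "(norm (X n - x\<^sub>0))\<^sup>2 < d\<^sup>2" using e by linarith
      then show ?case using \<open>d > 0\<close> by (simp add: dist_norm power_less_imp_less_base)
    qed
  qed
  moreover have "\<forall>\<^sub>F n in sequentially. X n \<in> lattice (h n)"
    using Y_S by eventually_elim (metis X(1) S_def IntD1 empty_iff)
  moreover have "\<forall>\<^sub>F n in sequentially. \<forall>y \<in> lattice (h n) \<inter> cball x\<^sub>0 r. f n y \<le> f n (X n)"
    using Y_S by eventually_elim (metis X(2) S_def empty_iff)
  ultimately show thesis by (rule that)
qed

text \<open>The dynamic programming inequality is tested with the velocity dual to the gradient of
  the test function. Dividing by \<open>\<tau> n\<close> and passing to the limit gives an
  inequality for \<open>lagrangian H\<close>, which the equality case of Fenchel turns into one for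
  \<open>H\<close>.\<close>

lemma viscosity_subsolution_limit:
  fixes H :: "real ^ 'n \<Rightarrow> real ^ 'n \<Rightarrow> real"
  assumes H: "tonelli_hamiltonian H"
    and sol: "\<And>n. lattice_solution (lagrangian H) (h n) (\<tau> n) (c n) (w n)"
    and h: "\<And>n. h n > 0" "h \<longlonglongrightarrow> 0" and \<tau>: "\<And>n. \<tau> n > 0" "\<tau> \<longlonglongrightarrow> 0"
    and h\<tau>: "(\<lambda>n. h n / \<tau> n) \<longlonglongrightarrow> 0" and c: "c \<longlonglongrightarrow> \<gamma>"
    and unif: "uniform_limit UNIV w v sequentially" and cont: "continuous_on UNIV v"
  shows "viscosity_subsolution H (- \<gamma>) v"
  unfolding viscosity_subsolution_def
proof (intro allI impI)
  fix \<phi> :: "real ^ 'n \<Rightarrow> real" and D\<phi> x\<^sub>0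
  assume \<phi>: "C1_gradient \<phi> D\<phi>" and max: "\<forall>\<^sub>F y in nhds x\<^sub>0. v y - \<phi> y \<le> v x\<^sub>0 - \<phi> x\<^sub>0"
  \<comment> \<open>The quadratic term makes the maximum strict and changes neither the value nor
    the gradient at \<open>x\<^sub>0\<close>.\<close>
  define \<psi> where "\<psi> y = \<phi> y + (norm (y - x\<^sub>0))\<^sup>2" for y
  define D\<psi> where "D\<psi> y = D\<phi> y + 2 *\<^sub>R (y - x\<^sub>0)" for y
  have D\<psi>: "GDERIV \<psi> y :> D\<psi> y" for y
    using \<phi> unfolding \<psi>_def D\<psi>_def C1_gradient_def
    by (intro GDERIV_add GDERIV_dist_square) blast
  have cont_D\<psi>: "isCont D\<psi> x\<^sub>0"
    using \<phi> unfolding D\<psi>_def C1_gradient_def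
    by (auto intro!: continuous_intros simp: continuous_on_eq_continuous_at)
  have isCont_\<psi>: "isCont \<psi> x\<^sub>0"
    using D\<psi> has_derivative_continuous unfolding gderiv_def by blast
  have p: "D\<psi> x\<^sub>0 = D\<phi> x\<^sub>0" by (simp add: D\<psi>_def)
  obtain r where r: "r > 0" "\<And>y. y \<in> cball x\<^sub>0 r \<Longrightarrow> v y - \<phi> y \<le> v x\<^sub>0 - \<phi> x\<^sub>0"
    using max unfolding eventually_nhds_metric
    by (metis dist_commute mem_cball dense le_less_trans)
  obtain X where X: "X \<longlonglongrightarrow> x\<^sub>0" "\<forall>\<^sub>F n in sequentially. X n \<in> lattice (h n)"
    and Xmax: "\<forall>\<^sub>F n in sequentially. \<forall>y \<in> lattice (h n) \<inter> cball x\<^sub>0 r. w n y - \<psi> y \<le> w n (X n) - \<psi> (X n)"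
  proof (rule lattice_maxima_converge[OF h r(1), of "\<lambda>n y. w n y - \<psi> y" "\<lambda>y. v y - \<psi> y" x\<^sub>0])
    show "uniform_limit UNIV (\<lambda>n y. w n y - \<psi> y) (\<lambda>y. v y - \<psi> y) sequentially"
      using unif by (simp add: uniform_limit_iff dist_norm)
    show "isCont (\<lambda>y. v y - \<psi> y) x\<^sub>0"
      using cont isCont_\<psi> by (auto intro!: continuous_intros simp: continuous_on_eq_continuous_at)
    show "v x - \<psi> x \<le> v x\<^sub>0 - \<psi> x\<^sub>0 - (norm (x - x\<^sub>0))\<^sup>2" if "x \<in> cball x\<^sub>0 r" for x
      using r(2)[OF that] by (simp add: \<psi>_def)
  qed
  obtain v\<^sub>0 where v\<^sub>0: "\<And>q. H x\<^sub>0 (D\<phi> x\<^sub>0) + v\<^sub>0 \<bullet> (q - D\<phi> x\<^sub>0) \<le> H x\<^sub>0 q"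
    using tonelli_subgradient[OF H] by blast
  \<comment> \<open>One step backwards with velocity \<open>v\<^sub>0\<close>, rounded to the
    lattice. Rounding changes the velocity by order \<open>h n / \<tau> n\<close>, hence
    negligibly.\<close>
  define Y where "Y n = lattice_round (h n) (X n - \<tau> n *\<^sub>R v\<^sub>0)" for n
  define V where "V n = (X n - Y n) /\<^sub>R \<tau> n" for n
  have V: "V \<longlonglongrightarrow> v\<^sub>0"
  proof (rule LIM_zero_cancel, rule Lim_null_comparison[OF always_eventually])
    show "\<forall>n. norm (V n - v\<^sub>0) \<le> real CARD('n) * (h n / \<tau> n)"
    proof
      fix n
      have "V n - v\<^sub>0 = - (Y n - (X n - \<tau> n *\<^sub>R v\<^sub>0)) /\<^sub>R \<tau> n"
        using \<tau>(1)[of n] by (simp add: V_def algebra_simps)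
      then have "norm (V n - v\<^sub>0) = norm (Y n - (X n - \<tau> n *\<^sub>R v\<^sub>0)) / \<tau> n"
        using \<tau>(1)[of n] by (simp only: norm_scaleR norm_minus_cancel) (simp add: divide_inverse)
      then show "norm (V n - v\<^sub>0) \<le> real CARD('n) * (h n / \<tau> n)"
        using lattice_round_dist[OF h(1)[of n], of "X n - \<tau> n *\<^sub>R v\<^sub>0"] \<tau>(1)[of n]
        by (simp add: Y_def divide_right_mono)
    qed
    show "(\<lambda>n. real CARD('n) * (h n / \<tau> n)) \<longlonglongrightarrow> 0"
      using tendsto_mult_right_zero[OF h\<tau>] .
  qed
  have XY: "X n - Y n = \<tau> n *\<^sub>R V n" for n using \<tau>(1)[of n] by (simp add: V_def)
  have "(\<lambda>n. \<tau> n *\<^sub>R V n) \<longlonglongrightarrow> 0 *\<^sub>R v\<^sub>0" by (intro tendsto_intros \<tau> V)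
  then have XY0: "(\<lambda>n. X n - Y n) \<longlonglongrightarrow> 0" by (simp add: XY)
  have Y: "Y \<longlonglongrightarrow> x\<^sub>0" using tendsto_diff[OF X(1) XY0] by simp
  have "\<exists>\<xi>. norm (\<xi> - Y n) \<le> norm (X n - Y n) \<and> \<psi> (X n) - \<psi> (Y n) = D\<psi> \<xi> \<bullet> (X n - Y n)" for n
    using gradient_mean_value[OF D\<psi>] by metis
  then obtain \<xi> where \<xi>: "\<And>n. norm (\<xi> n - Y n) \<le> norm (X n - Y n)"
    "\<And>n. \<psi> (X n) - \<psi> (Y n) = D\<psi> (\<xi> n) \<bullet> (X n - Y n)"
    by metis
  have "(\<lambda>n. \<xi> n - Y n) \<longlonglongrightarrow> 0"
    by (rule Lim_null_comparison[OF always_eventually tendsto_norm_zero[OF XY0]]) (use \<xi>(1) in blast)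
  from tendsto_add[OF this Y] have "\<xi> \<longlonglongrightarrow> x\<^sub>0" by simp
  then have D\<xi>: "(\<lambda>n. D\<psi> (\<xi> n)) \<longlonglongrightarrow> D\<phi> x\<^sub>0"
    using isCont_tendsto_compose[OF cont_D\<psi>] p by metis
  have "H x\<^sub>0 (D\<phi> x\<^sub>0) \<le> - \<gamma> + \<epsilon>" if "\<epsilon> > 0" for \<epsilon>
  proof -
    obtain \<delta> where \<delta>: "\<delta> > 0" "\<And>x v. norm (x - x\<^sub>0) < \<delta> \<Longrightarrow> norm (v - v\<^sub>0) < \<delta> \<Longrightarrow>
        lagrangian H x v < lagrangian H x\<^sub>0 v\<^sub>0 + \<epsilon>"
      using lagrangian_upper_semicontinuous[OF H \<open>\<epsilon> > 0\<close>] by blast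
    have "\<forall>\<^sub>F n in sequentially. D\<psi> (\<xi> n) \<bullet> V n + c n \<le> lagrangian H x\<^sub>0 v\<^sub>0 + \<epsilon>"
      using X(2) Xmax tendstoD[OF Y r(1)] tendstoD[OF Y \<delta>(1)] tendstoD[OF V \<delta>(1)]
    proof eventually_elim
      case (elim n)
      have Yl: "Y n \<in> lattice (h n)" by (simp add: Y_def lattice_round_in)
      have "w n (Y n) - \<psi> (Y n) \<le> w n (X n) - \<psi> (X n)"
        using elim(2,3) Yl by (simp add: dist_commute)
      moreover have "w n (X n) + \<tau> n * c n \<le> w n (Y n) + \<tau> n * lagrangian H (Y n) (V n)"
        using lattice_solution_upper[OF sol Yl elim(1)] by (simp add: V_def)
      moreover have "\<psi> (X n) - \<psi> (Y n) = \<tau> n * (D\<psi> (\<xi> n) \<bullet> V n)"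
        by (simp add: \<xi>(2) XY)
      ultimately have "\<tau> n * (D\<psi> (\<xi> n) \<bullet> V n + c n) \<le> \<tau> n * lagrangian H (Y n) (V n)"
        by (simp add: algebra_simps)
      then have "D\<psi> (\<xi> n) \<bullet> V n + c n \<le> lagrangian H (Y n) (V n)" using \<tau>(1)[of n] by simp
      also have "\<dots> \<le> lagrangian H x\<^sub>0 v\<^sub>0 + \<epsilon>"
        using \<delta>(2) elim(4,5) by (simp add: dist_norm less_imp_le)
      finally show ?case .
    qed
    then have "D\<phi> x\<^sub>0 \<bullet> v\<^sub>0 + \<gamma> \<le> lagrangian H x\<^sub>0 v\<^sub>0 + \<epsilon>"
      by (intro tendsto_upperbound[OF tendsto_add[OF tendsto_inner[OF D\<xi> V] c]]) auto
    then show ?thesis using lagrangian_at_subgradient[of H x\<^sub>0 "D\<phi> x\<^sub>0" v\<^sub>0, OF v\<^sub>0] by linarith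
  qed
  then show "H x\<^sub>0 (D\<phi> x\<^sub>0) \<le> - \<gamma>" by (rule field_le_epsilon)
qed

text \<open>Here the step is dictated by the equation: \<open>Y n\<close> is a near-optimal
  predecessor of \<open>X n\<close>. Once its velocity is bounded, both points converge to
  \<open>x\<^sub>0\<close>, and Fenchel's inequality at the momentum from the mean value theorem
  bounds \<open>H\<close> from below.\<close>

lemma viscosity_supersolution_limit:
  fixes H :: "real ^ 'n \<Rightarrow> real ^ 'n \<Rightarrow> real"
  assumes H: "tonelli_hamiltonian H"
    and sol: "\<And>n. lattice_solution (lagrangian H) (h n) (\<tau> n) (c n) (w n)"
    and h: "\<And>n. h n > 0" "h \<longlonglongrightarrow> 0" and \<tau>: "\<And>n. \<tau> n > 0" "\<tau> \<longlonglongrightarrow> 0"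
    and c: "c \<longlonglongrightarrow> \<gamma>" and "0 \<le> A"
    and est: "\<And>n x y. \<lbrakk>x \<in> lattice (h n); y \<in> lattice (h n)\<rbrakk> \<Longrightarrow>
      w n y - w n x \<le> A * (norm (y - x) + \<tau> n)"
    and unif: "uniform_limit UNIV w v sequentially" and cont: "continuous_on UNIV v"
  shows "viscosity_supersolution H (- \<gamma>) v"
  unfolding viscosity_supersolution_def
proof (intro allI impI)
  fix \<phi> :: "real ^ 'n \<Rightarrow> real" and D\<phi> x\<^sub>0
  assume \<phi>: "C1_gradient \<phi> D\<phi>" and min: "\<forall>\<^sub>F y in nhds x\<^sub>0. v y - \<phi> y \<ge> v x\<^sub>0 - \<phi> x\<^sub>0"
  have sup: "superlinear H" using H by (simp add: tonelli_hamiltonian_def)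
  define \<psi> where "\<psi> y = \<phi> y - (norm (y - x\<^sub>0))\<^sup>2" for y
  define D\<psi> where "D\<psi> y = D\<phi> y - 2 *\<^sub>R (y - x\<^sub>0)" for y
  have D\<psi>: "GDERIV \<psi> y :> D\<psi> y" for y
    using \<phi> unfolding \<psi>_def D\<psi>_def C1_gradient_def
    by (intro GDERIV_diff GDERIV_dist_square) blast
  have cont_D\<psi>: "isCont D\<psi> x\<^sub>0"
    using \<phi> unfolding D\<psi>_def C1_gradient_def
    by (auto intro!: continuous_intros simp: continuous_on_eq_continuous_at)
  have isCont_\<psi>: "isCont \<psi> x\<^sub>0"
    using D\<psi> has_derivative_continuous unfolding gderiv_def by blast
  have p: "D\<psi> x\<^sub>0 = D\<phi> x\<^sub>0" by (simp add: D\<psi>_def)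
  obtain r where r: "r > 0" "\<And>y. y \<in> cball x\<^sub>0 r \<Longrightarrow> v y - \<phi> y \<ge> v x\<^sub>0 - \<phi> x\<^sub>0"
    using min unfolding eventually_nhds_metric
    by (metis dist_commute mem_cball dense le_less_trans)
  obtain X where X: "X \<longlonglongrightarrow> x\<^sub>0" "\<forall>\<^sub>F n in sequentially. X n \<in> lattice (h n)"
    and Xmin: "\<forall>\<^sub>F n in sequentially. \<forall>y \<in> lattice (h n) \<inter> cball x\<^sub>0 r. \<psi> y - w n y \<le> \<psi> (X n) - w n (X n)"
  proof (rule lattice_maxima_converge[OF h r(1), of "\<lambda>n y. \<psi> y - w n y" "\<lambda>y. \<psi> y - v y" x\<^sub>0])
    show "uniform_limit UNIV (\<lambda>n y. \<psi> y - w n y) (\<lambda>y. \<psi> y - v y) sequentially"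
      using unif by (simp add: uniform_limit_iff dist_norm abs_minus_commute)
    show "isCont (\<lambda>y. \<psi> y - v y) x\<^sub>0"
      using cont isCont_\<psi> by (auto intro!: continuous_intros simp: continuous_on_eq_continuous_at)
    show "\<psi> x - v x \<le> \<psi> x\<^sub>0 - v x\<^sub>0 - (norm (x - x\<^sub>0))\<^sup>2" if "x \<in> cball x\<^sub>0 r" for x
      using r(2)[OF that] by (simp add: \<psi>_def)
  qed
  \<comment> \<open>The tolerance \<open>\<tau> n * \<tau> n\<close> still tends to 0 after division
    by \<open>\<tau> n\<close>.\<close>
  have "\<exists>y. X n \<in> lattice (h n) \<longrightarrow> y \<in> lattice (h n) \<and>
      w n y + \<tau> n * lagrangian H y ((X n - y) /\<^sub>R \<tau> n) < w n (X n) + \<tau> n * c n + \<tau> n * \<tau> n" for n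
    using lattice_solution_approx[OF sol, of "X n" n "\<tau> n * \<tau> n"] \<tau>(1)[of n]
    by (metis mult_pos_pos)
  then obtain Y where Y_lattice: "\<And>n. X n \<in> lattice (h n) \<Longrightarrow> Y n \<in> lattice (h n)"
    and Y_le: "\<And>n. X n \<in> lattice (h n) \<Longrightarrow>
      w n (Y n) + \<tau> n * lagrangian H (Y n) ((X n - Y n) /\<^sub>R \<tau> n) < w n (X n) + \<tau> n * c n + \<tau> n * \<tau> n"
    by metis
  define V where "V n = (X n - Y n) /\<^sub>R \<tau> n" for n
  have XY: "X n - Y n = \<tau> n *\<^sub>R V n" for n using \<tau>(1)[of n] by (simp add: V_def)
  have LV: "lagrangian H (Y n) (V n) + (w n (Y n) - w n (X n)) / \<tau> n < c n + \<tau> n"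
    if "X n \<in> lattice (h n)" for n
  proof -
    have "\<tau> n * (lagrangian H (Y n) (V n) + (w n (Y n) - w n (X n)) / \<tau> n) < \<tau> n * (c n + \<tau> n)"
      using Y_le[OF that] \<tau>(1)[of n] by (simp add: V_def distrib_left)
    then show ?thesis using \<tau>(1)[of n] by simp
  qed
  \<comment> \<open>The gain of \<open>w\<close> along the step grows in the velocity with slope
    \<open>A\<close>; cost growing with slope \<open>A + 1\<close> leaves one multiple of
    \<open>norm (V n)\<close> to be bounded.\<close>
  obtain C where C: "\<And>x v. lagrangian H x v \<ge> (A + 1) * norm v - C"
    using lagrangian_superlinear[OF H] \<open>0 \<le> A\<close> unfolding superlinear_def
    by (metis add_nonneg_pos zero_less_one)
  have V_bound: "norm (V n) \<le> C + A + c n + \<tau> n" if X_lattice: "X n \<in> lattice (h n)" for n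
  proof -
    have "w n (X n) - w n (Y n) \<le> A * (norm (X n - Y n) + \<tau> n)"
      using est[OF Y_lattice[OF X_lattice] X_lattice] .
    also have "\<dots> = \<tau> n * (A * (norm (V n) + 1))"
      using \<tau>(1)[of n] by (simp add: XY algebra_simps)
    finally have "(w n (X n) - w n (Y n)) / \<tau> n \<le> A * (norm (V n) + 1)"
      using \<tau>(1)[of n] by (simp add: pos_divide_le_eq mult.commute)
    then show ?thesis
      using LV[OF X_lattice] C[of "V n" "Y n"] by (simp add: algebra_simps diff_divide_distrib)
  qed
  have "(\<lambda>n. \<tau> n * (C + A + c n + \<tau> n)) \<longlonglongrightarrow> 0 * (C + A + \<gamma> + 0)"
    by (intro tendsto_intros \<tau> c)
  then have "(\<lambda>n. \<tau> n * (C + A + c n + \<tau> n)) \<longlonglongrightarrow> 0" by simp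
  then have XY0: "(\<lambda>n. X n - Y n) \<longlonglongrightarrow> 0"
  proof (rule Lim_null_comparison[rotated])
    show "\<forall>\<^sub>F n in sequentially. norm (X n - Y n) \<le> \<tau> n * (C + A + c n + \<tau> n)"
      using X(2)
    proof eventually_elim
      case (elim n)
      then show ?case using V_bound[OF elim] \<tau>(1)[of n] by (simp add: XY)
    qed
  qed
  have Y: "Y \<longlonglongrightarrow> x\<^sub>0" using tendsto_diff[OF X(1) XY0] by simp
  have "\<exists>\<xi>. norm (\<xi> - Y n) \<le> norm (X n - Y n) \<and> \<psi> (X n) - \<psi> (Y n) = D\<psi> \<xi> \<bullet> (X n - Y n)" for n
    using gradient_mean_value[OF D\<psi>] by metis
  then obtain \<xi> where \<xi>: "\<And>n. norm (\<xi> n - Y n) \<le> norm (X n - Y n)"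
    "\<And>n. \<psi> (X n) - \<psi> (Y n) = D\<psi> (\<xi> n) \<bullet> (X n - Y n)"
    by metis
  have "(\<lambda>n. \<xi> n - Y n) \<longlonglongrightarrow> 0"
    by (rule Lim_null_comparison[OF always_eventually tendsto_norm_zero[OF XY0]]) (use \<xi>(1) in blast)
  from tendsto_add[OF this Y] have "\<xi> \<longlonglongrightarrow> x\<^sub>0" by simp
  then have D\<xi>: "(\<lambda>n. D\<psi> (\<xi> n)) \<longlonglongrightarrow> D\<phi> x\<^sub>0"
    using isCont_tendsto_compose[OF cont_D\<psi>] p by metis
  have "isCont (\<lambda>(x, p). H x p) (x\<^sub>0, D\<phi> x\<^sub>0)"
    using tonelli_continuous[OF H] by (simp add: continuous_on_eq_continuous_at)
  from isCont_tendsto_compose[OF this tendsto_Pair[OF Y D\<xi>]]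
  have H_lim: "(\<lambda>n. H (Y n) (D\<psi> (\<xi> n))) \<longlonglongrightarrow> H x\<^sub>0 (D\<phi> x\<^sub>0)" by simp
  have "\<forall>\<^sub>F n in sequentially. - c n - \<tau> n \<le> H (Y n) (D\<psi> (\<xi> n))"
    using X(2) Xmin tendstoD[OF Y r(1)]
  proof eventually_elim
    case (elim n)
    have "\<psi> (Y n) - w n (Y n) \<le> \<psi> (X n) - w n (X n)"
      using elim(2,3) Y_lattice[OF elim(1)] by (simp add: dist_commute)
    then have "w n (X n) - w n (Y n) \<le> \<tau> n * (D\<psi> (\<xi> n) \<bullet> V n)"
      using \<xi>(2)[of n] by (simp add: XY)
    then have "(w n (X n) - w n (Y n)) / \<tau> n \<le> D\<psi> (\<xi> n) \<bullet> V n"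
      using \<tau>(1)[of n] by (simp add: pos_divide_le_eq mult.commute)
    then show ?case
      using LV[OF elim(1)] fenchel[OF sup, of "D\<psi> (\<xi> n)" "V n" "Y n"]
      by (simp add: diff_divide_distrib)
  qed
  moreover have "(\<lambda>n. - c n - \<tau> n) \<longlonglongrightarrow> - \<gamma> - 0" by (intro tendsto_intros c \<tau>)
  ultimately show "H x\<^sub>0 (D\<phi> x\<^sub>0) \<ge> - \<gamma>"
    using tendsto_le[OF _ H_lim, of "\<lambda>n. - c n - \<tau> n" "- \<gamma>"] by simp
qed

section \<open>Uniqueness of the critical value\<close>

lemma bounded_periodic:
  fixes u :: "real ^ 'n \<Rightarrow> real"
  assumes "periodic u" "continuous_on UNIV u"
  obtains M where "\<And>x. \<bar>u x\<bar> \<le> M"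
proof -
  have "compact (u ` cbox 0 1)"
    using assms(2) by (intro compact_continuous_image compact_cbox) (auto intro: continuous_on_subset)
  then obtain M where "\<And>y. y \<in> u ` cbox 0 1 \<Longrightarrow> norm y \<le> M"
    by (meson compact_imp_bounded bounded_iff)
  then have "\<bar>u x\<bar> \<le> M" for x
    using fractional_part_cbox[of x] periodic_fractional_part[OF assms(1), of x]
    by (metis imageI real_norm_def)
  then show thesis by (rule that)
qed

text \<open>Doubling of variables. At a maximum the quadratic penalty supplies test functions for
  both solutions with the same momentum \<open>p\<close>. Superlinearity and the subsolution
  property bound \<open>p\<close> independently of the penalty, so a large penalty brings the two
  points too close for the gap between the levels.\<close>

lemma viscosity_comparison:
  fixes H :: "real ^ 'n \<Rightarrow> real ^ 'n \<Rightarrow> real"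
  assumes H: "tonelli_hamiltonian H"
    and u\<^sub>1: "viscosity_solution H c\<^sub>1 u\<^sub>1" and u\<^sub>2: "viscosity_solution H c\<^sub>2 u\<^sub>2"
  shows "c\<^sub>2 \<le> c\<^sub>1"
proof (rule ccontr)
  assume "\<not> c\<^sub>2 \<le> c\<^sub>1"
  then have gap: "c\<^sub>2 - c\<^sub>1 > 0" by simp
  have per: "periodic u\<^sub>1" "periodic u\<^sub>2" and cont: "continuous_on UNIV u\<^sub>1" "continuous_on UNIV u\<^sub>2"
    using u\<^sub>1 u\<^sub>2 by (simp_all add: viscosity_solution_def)
  obtain M\<^sub>1 where M\<^sub>1: "\<And>x. \<bar>u\<^sub>1 x\<bar> \<le> M\<^sub>1" using bounded_periodic[OF per(1) cont(1)] by blast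
  obtain M\<^sub>2 where M\<^sub>2: "\<And>x. \<bar>u\<^sub>2 x\<bar> \<le> M\<^sub>2" using bounded_periodic[OF per(2) cont(2)] by blast
  obtain C where C: "\<And>x p. H x p \<ge> 1 * norm p - C"
    using H unfolding tonelli_hamiltonian_def superlinear_def by (meson zero_less_one)
  define P where "P = \<bar>c\<^sub>1 + C\<bar>"
  obtain \<delta> where \<delta>: "\<delta> > 0"
    "\<And>x y p. norm p \<le> P \<Longrightarrow> norm (x - y) < \<delta> \<Longrightarrow> \<bar>H x p - H y p\<bar> < c\<^sub>2 - c\<^sub>1"
    using tonelli_uniformly_continuous[OF H gap] by blast
  \<comment> \<open>The momentum has length \<open>k * norm (x - y)\<close> and is at most
    \<open>P\<close>, so this \<open>k\<close> forces
    \<open>norm (x - y) < \<delta>\<close>.\<close>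
  define k where "k = (P + 1) / \<delta>"
  have k: "k > 0" using \<delta>(1) by (simp add: k_def P_def)
  \<comment> \<open>In the variables \<open>x\<close> and \<open>d = y - x\<close> the function is
    periodic in \<open>x\<close>, while the penalty confines \<open>d\<close>; a maximum over a
    compact set is thus global.\<close>
  define \<Phi> where "\<Phi> = (\<lambda>(x, d). u\<^sub>1 x - u\<^sub>2 (x + d) - k / 2 * (norm d)\<^sup>2)"
  \<comment> \<open>Beyond this radius the penalty exceeds twice
    \<open>M\<^sub>1 + M\<^sub>2\<close>, so \<open>(0, 0)\<close> does at least as well. The
    summand 1 ensures that the square of \<open>norm d\<close> dominates \<open>R\<close>.\<close>
  define R where "R = 4 * (M\<^sub>1 + M\<^sub>2) / k + 1"
  have M: "0 \<le> M\<^sub>1 + M\<^sub>2" using M\<^sub>1[of 0] M\<^sub>2[of 0] by linarith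
  then have R: "R \<ge> 1" using k by (simp add: R_def)
  let ?K = "cbox 0 1 \<times> cball 0 R :: ((real ^ 'n) \<times> (real ^ 'n)) set"
  have "continuous_on ?K \<Phi>"
    unfolding \<Phi>_def case_prod_beta
    by (intro continuous_intros continuous_on_compose2[OF cont(1)] continuous_on_compose2[OF cont(2)]) auto
  moreover have "compact ?K" by (intro compact_Times compact_cbox compact_cball)
  moreover have "(0, 0) \<in> ?K" using R by (simp add: mem_box_cart)
  ultimately obtain z where z: "z \<in> ?K" "\<And>z'. z' \<in> ?K \<Longrightarrow> \<Phi> z' \<le> \<Phi> z"
    using continuous_attains_sup[of ?K \<Phi>] by blast
  have global: "\<Phi> (x, d) \<le> \<Phi> z" for x d
  proof (cases "norm d \<le> R")
    case True
    have "u\<^sub>2 (fractional_part x + d) = u\<^sub>2 (x + d)"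
      by (rule periodic_cong_lattice[OF per(2)]) (use fractional_part_diff[of x] in simp)
    then have "\<Phi> (x, d) = \<Phi> (fractional_part x, d)"
      by (simp add: \<Phi>_def periodic_fractional_part[OF per(1)])
    also have "\<dots> \<le> \<Phi> z" using z(2) True by (simp add: fractional_part_cbox)
    finally show ?thesis .
  next
    case False
    then have "R \<le> (norm d)\<^sup>2" using R by (smt (verit) power2_eq_square mult_le_cancel_left1)
    then have R_le: "k / 2 * R \<le> k / 2 * (norm d)\<^sup>2" using k by simp
    have "2 * M\<^sub>1 + 2 * M\<^sub>2 \<le> 2 * M\<^sub>1 + 2 * M\<^sub>2 + k / 2" using k by simp
    also have "\<dots> = k / 2 * R" using k by (simp add: R_def field_simps)
    also note R_le
    finally have "2 * M\<^sub>1 + 2 * M\<^sub>2 \<le> k / 2 * (norm d)\<^sup>2" .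
    moreover have "u\<^sub>1 x - u\<^sub>2 (x + d) \<le> M\<^sub>1 + M\<^sub>2" "u\<^sub>2 0 - u\<^sub>1 0 \<le> M\<^sub>1 + M\<^sub>2"
      using M\<^sub>1[of x] M\<^sub>1[of 0] M\<^sub>2[of "x + d"] M\<^sub>2[of 0] by linarith+
    ultimately have "u\<^sub>1 x - u\<^sub>2 (x + d) - k / 2 * (norm d)\<^sup>2 \<le> u\<^sub>1 0 - u\<^sub>2 0" by linarith
    then have "\<Phi> (x, d) \<le> \<Phi> (0, 0)" by (simp add: \<Phi>_def)
    also have "\<dots> \<le> \<Phi> z" using z(2)[of "(0, 0)"] R by (simp add: mem_box_cart)
    finally show ?thesis .
  qed
  obtain x d where zxd: "z = (x, d)" by (cases z)
  define y where "y = x + d"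
  define p where "p = k *\<^sub>R (x - y)"
  have max: "u\<^sub>1 x' - u\<^sub>2 y' - k / 2 * (norm (x' - y'))\<^sup>2 \<le> u\<^sub>1 x - u\<^sub>2 y - k / 2 * (norm (x - y))\<^sup>2" for x' y'
    using global[of x' "y' - x'"] by (simp add: zxd \<Phi>_def y_def norm_minus_commute)
  have square: "GDERIV (\<lambda>x. s * (norm (x - a))\<^sup>2) x :> (2 * s) *\<^sub>R (x - a)" for s and x a :: "real ^ 'n"
    using GDERIV_mult[OF GDERIV_const[of s] GDERIV_dist_square[of a x]] by (simp add: mult.commute)
  have "C1_gradient (\<lambda>x'. k / 2 * (norm (x' - y))\<^sup>2) (\<lambda>x'. k *\<^sub>R (x' - y))"
    using square[of "k / 2" y] by (auto simp: C1_gradient_def intro!: continuous_intros)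
  moreover have "\<forall>\<^sub>F x' in nhds x. u\<^sub>1 x' - k / 2 * (norm (x' - y))\<^sup>2 \<le> u\<^sub>1 x - k / 2 * (norm (x - y))\<^sup>2"
    using max[of _ y] by (intro always_eventually) simp
  ultimately have H1: "H x p \<le> c\<^sub>1"
    using u\<^sub>1 unfolding viscosity_solution_def viscosity_subsolution_def p_def by blast
  have grad2: "C1_gradient (\<lambda>y'. - k / 2 * (norm (y' - x))\<^sup>2) (\<lambda>y'. - k *\<^sub>R (y' - x))"
    using square[of "- k / 2" x] by (auto simp: C1_gradient_def intro!: continuous_intros)
  have min: "\<forall>\<^sub>F y' in nhds y.
      u\<^sub>2 y' - (- k / 2 * (norm (y' - x))\<^sup>2) \<ge> u\<^sub>2 y - (- k / 2 * (norm (y - x))\<^sup>2)"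
  proof (intro always_eventually allI)
    fix y'
    show "u\<^sub>2 y' - (- k / 2 * (norm (y' - x))\<^sup>2) \<ge> u\<^sub>2 y - (- k / 2 * (norm (y - x))\<^sup>2)"
      using max[of x y'] by (simp add: norm_minus_commute)
  qed
  have "viscosity_supersolution H c\<^sub>2 u\<^sub>2" using u\<^sub>2 by (simp add: viscosity_solution_def)
  from this[unfolded viscosity_supersolution_def, rule_format, OF grad2 min]
  have "H y (- k *\<^sub>R (y - x)) \<ge> c\<^sub>2" .
  moreover have "- k *\<^sub>R (y - x) = p" by (simp add: p_def algebra_simps)
  ultimately have H2: "H y p \<ge> c\<^sub>2" by simp
  have p: "norm p \<le> P" using C[where x = x and p = p] H1 by (simp add: P_def)
  moreover have "norm (x - y) < \<delta>"
  proof -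
    have "k * norm (x - y) < P + 1" using p k by (simp add: p_def)
    also have "P + 1 = k * \<delta>" using \<delta>(1) by (simp add: k_def)
    finally show ?thesis using k by simp
  qed
  ultimately show False using \<delta>(2)[of p x y] H1 H2 by linarith
qed

text \<open>Comparison applied in both directions makes the level unique, so the definite
  description in \<open>critical_value\<close> denotes it.\<close>

lemma critical_value_eq:
  assumes "tonelli_hamiltonian H" "viscosity_solution H c u"
  shows "critical_value H = c"
  unfolding critical_value_def
proof (rule the_equality)
  show "\<exists>u. viscosity_solution H c u" using assms(2) by blast
  show "c' = c" if "\<exists>u. viscosity_solution H c' u" for c'
    using that viscosity_comparison[OF assms(1)] assms(2) by (meson antisym)
qed

section \<open>Extraction of the subsequence and identification of the limit\<close>

theorem proposition3p4:
  fixes H :: "real ^ 'n \<Rightarrow> real ^ 'n \<Rightarrow> real"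
    and h \<tau> :: "nat \<Rightarrow> real"
    and u w :: "nat \<Rightarrow> real ^ 'n \<Rightarrow> real"
    and z :: "nat \<Rightarrow> real ^ 'n"
    and \<T> :: "nat \<Rightarrow> (real ^ 'n) set set"
  assumes "tonelli_hamiltonian H"
    and "\<And>n. mesh_size (h n)"
    and "\<And>n. \<tau> n > 0"
    and "\<tau> \<longlonglongrightarrow> 0"
    and "h \<longlonglongrightarrow> 0"
    and "(\<lambda>n. h n / \<tau> n) \<longlonglongrightarrow> 0"
    and "\<And>n. discrete_solution (lagrangian H) (h n) (\<tau> n)
               (effective_lagrangian (lagrangian H) (h n) (\<tau> n)) (u n)"
    and "\<And>n. z n \<in> grid (h n)"
    and "\<And>n. u n (z n) = 0"
    and "\<And>n. grid_triangulation (h n) (\<T> n)"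
    and "\<And>n. pw_affine_interpolation (h n) (\<T> n) (u n) (w n)"
  shows "\<exists>(r :: nat \<Rightarrow> nat) (v :: real ^ 'n \<Rightarrow> real).
           strict_mono r \<and>
           periodic v \<and> (\<exists>C. C-lipschitz_on UNIV v) \<and>
           uniform_limit UNIV (\<lambda>n. w (r n)) v sequentially \<and>
           viscosity_solution H (critical_value H) v"
proof -
  define L where "L = lagrangian H"
  define c where "c n = effective_lagrangian L (h n) (\<tau> n)" for n
  have sup: "superlinear H" and per: "periodic H"
    using assms(1) by (simp_all add: tonelli_hamiltonian_def)
  have L: "superlinear L" "periodic L"
    unfolding L_def by (intro lagrangian_superlinear lagrangian_periodic assms(1) per)+
  have h: "h n > 0" for n by (rule mesh_size_pos[OF assms(2)])
  have w: "periodic (w n)" "continuous_on UNIV (w n)" "\<And>x. x \<in> grid (h n) \<Longrightarrow> w n x = u n x"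
    and affine: "\<And>T. T \<in> \<T> n \<Longrightarrow> \<exists>a b. \<forall>x \<in> T. w n x = a \<bullet> x + b" for n
    using assms(11)[of n] by (simp_all add: pw_affine_interpolation_def)
  \<comment> \<open>The interpolation is periodic and agrees with \<open>u n\<close> on the grid, so
    it is itself the lift of the grid solution to the lattice.\<close>
  have sol: "lattice_solution L (h n) (\<tau> n) (c n) (w n)" for n
    by (rule lattice_solutionI[OF assms(2,3) L w(1,3)]) (use assms(7) in \<open>auto simp: L_def c_def\<close>)
  obtain B where B: "\<And>n. \<bar>h n / \<tau> n\<bar> \<le> B"
    using convergent_imp_Bseq[OF convergentI[OF assms(6)]] by (auto simp: Bseq_def)
  have hB: "h n \<le> B * \<tau> n" for n
    using B[of n] assms(3)[of n] h[of n] by (simp add: pos_divide_le_eq)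
  obtain C where C: "\<And>x v. norm v \<le> 1 + 2 * real CARD('n) * B \<Longrightarrow> L x v \<le> C"
    unfolding L_def using lagrangian_bounded_above[OF sup] by blast
  obtain C' where C': "\<And>x v. L x v \<ge> 1 * norm v - C'"
    using L(1) unfolding superlinear_def by (meson zero_less_one)
  have lower: "- C' \<le> L x v" for x v using C'[where x = x and v = v] norm_ge_zero[of v] by linarith
  have "0 \<le> B" using B[of 0] by linarith
  then have L0: "L x 0 \<le> C" for x by (intro C) simp
  note c_bounds = lattice_solution_eigenvalue_bounds[OF sol assms(2,3) lower L0]
  \<comment> \<open>The bounds \<open>- C' \<le> c n \<le> C\<close> make this constant work for all
    \<open>n\<close> at once and show it nonnegative.\<close>
  define A where "A = C + C'"
  have A: "C - c n \<le> A" "0 \<le> A" for n using c_bounds[of n] by (simp_all add: A_def)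
  have est: "w n y - w n x \<le> A * (norm (y - x) + \<tau> n)"
    if "x \<in> lattice (h n)" "y \<in> lattice (h n)" for n x y
    using lattice_solution_almost_lipschitz[OF sol h assms(3) hB C A that] .
  have "bounded (range c)" unfolding bounded_iff
    using c_bounds by (intro exI[of _ "max \<bar>C\<bar> \<bar>C'\<bar>"]) (smt (verit) rangeE real_norm_def)
  \<comment> \<open>A first extraction makes the constants converge. The second, below, makes the
    functions converge; \<open>- \<gamma>\<close> is identified with the critical value only at the
    end.\<close>
  then obtain \<gamma> s where s: "strict_mono (s :: nat \<Rightarrow> nat)" "(c \<circ> s) \<longlonglongrightarrow> \<gamma>"
    using bounded_imp_convergent_subsequence by blast
  have "(\<lambda>n. 2 * real CARD('n) * h n + \<tau> n) \<longlonglongrightarrow> 2 * real CARD('n) * 0 + 0"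
    by (intro tendsto_intros assms)
  then have \<epsilon>: "(\<lambda>n. 2 * real CARD('n) * h (s n) + \<tau> (s n)) \<longlonglongrightarrow> 0"
    using LIMSEQ_subseq_LIMSEQ[OF _ s(1)] by (fastforce simp: o_def)
  obtain r v where r: "strict_mono (r :: nat \<Rightarrow> nat)" and v: "periodic v" "A-lipschitz_on UNIV v"
    and unif: "uniform_limit UNIV (\<lambda>n. w (s (r n))) v sequentially"
  proof (rule almost_lipschitz_convergent_subsequence[OF _ _ _ A(2) \<epsilon>, of "\<lambda>n. w (s n)"])
    show "\<bar>w (s n) y - w (s n) x\<bar> \<le> A * (norm (y - x) + (2 * real CARD('n) * h (s n) + \<tau> (s n)))" for n x y
      by (rule pw_affine_almost_lipschitz[OF assms(10) affine est A(2)])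
    show "\<exists>x. w (s n) x = 0" for n using w(3)[OF assms(8)] assms(9) by metis
  qed (use w in auto)
  define q where "q = s \<circ> r"
  have q: "strict_mono q" unfolding q_def by (rule strict_mono_o[OF s(1) r])
  have c_lim: "(\<lambda>n. c (q n)) \<longlonglongrightarrow> \<gamma>"
    using LIMSEQ_subseq_LIMSEQ[OF s(2) r] by (simp add: o_def q_def)
  have lims: "(\<lambda>n. h (q n)) \<longlonglongrightarrow> 0" "(\<lambda>n. \<tau> (q n)) \<longlonglongrightarrow> 0" "(\<lambda>n. h (q n) / \<tau> (q n)) \<longlonglongrightarrow> 0"
    using assms(4-6)[THEN LIMSEQ_subseq_LIMSEQ, OF q] by (simp_all add: o_def)
  have unif': "uniform_limit UNIV (\<lambda>n. w (q n)) v sequentially" using unif by (simp add: q_def)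
  have cont: "continuous_on UNIV v" using v(2) by (rule lipschitz_on_continuous_on)
  have "viscosity_subsolution H (- \<gamma>) v"
    by (rule viscosity_subsolution_limit[OF assms(1) sol[unfolded L_def] h lims(1) assms(3) lims(2,3)
        c_lim unif' cont])
  moreover have "viscosity_supersolution H (- \<gamma>) v"
    by (rule viscosity_supersolution_limit[OF assms(1) sol[unfolded L_def] h lims(1) assms(3) lims(2)
        c_lim A(2) est unif' cont])
  ultimately have "viscosity_solution H (- \<gamma>) v"
    using v(1) cont by (simp add: viscosity_solution_def)
  then have "viscosity_solution H (critical_value H) v"
    using critical_value_eq[OF assms(1)] by metis
  then show ?thesis using q v unif' by blast
qed

end
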